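(* Let $r\geq 3$ and $k\geq 1$ be fixed integers. Then for all sufficiently large $n$ (depending on $r$ and $k$), if $G$ is a $B_{r,k}$-free graph on $n$ vertices, then \[ q(G)\leq q(T_{n,r}), \] with equality if and only if $G=T_{n,r}$ (up to isomorphism).
   Context: All graphs are finite and simple. A graph is $F$-free if it contains no subgraph (not necessarily induced) isomorphic to $F$. The join $G\vee H$ of two vertex-disjoint graphs is obtained from their union by joining each vertex of $G$ to each vertex of $H$. The generalized book is $B_{r,k}=K_r\vee I_k$, where $K_r$ is the complete graph on $r$ vertices and $I_k$ is an independent set (edgeless graph) on $k$ vertices. The Turán graph $T_{n,r}$ is the complete $r$-partite graph on $n$ vertices whose partite sets are as equal in size as possible. The signless Laplacian matrix of $G$ is $Q(G)=D(G)+A(G)$, where $D(G)$ is the diagonal matrix of vertex degrees and $A(G)$ is the adjacency matrix; $q(G)$ is the maximum modulus of the eigenvalues of $Q(G)$. *)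

theory Defs
  imports
    "Graph_Theory.Pair_Digraph"
    "Graph_Theory.Digraph_Isomorphism"
    "Jordan_Normal_Form.Spectral_Radius"
begin

text \<open>
  A finite simple graph is a \<^locale>\<open>pair_graph\<close>: a finite vertex set together with a symmetric
  irreflexive set of arcs, each edge being represented by its two orientations. In such a graph
  the degree of a vertex is its \<^const>\<open>out_degree\<close>.
\<close>

subsection \<open>Graphs\<close>

text \<open>The subgraph need not be induced.\<close>

definition subgraph_free :: "'b pair_pre_digraph \<Rightarrow> 'a pair_pre_digraph \<Rightarrow> bool" where
  "subgraph_free F G \<longleftrightarrow>
     \<not> (\<exists>H :: 'a pair_pre_digraph.
          subgraph (with_proj H) (with_proj G) \<and> digraph_iso (with_proj H) (with_proj F))"

text \<open>The sum type makes the two vertex sets disjoint.\<close>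

definition graph_join ::
  "'a pair_pre_digraph \<Rightarrow> 'b pair_pre_digraph \<Rightarrow> ('a + 'b) pair_pre_digraph" where
  "graph_join G H =
     \<lparr> pverts = pverts G <+> pverts H,
       parcs = map_prod Inl Inl ` parcs G \<union> map_prod Inr Inr ` parcs H
             \<union> (Inl ` pverts G) \<times> (Inr ` pverts H) \<union> (Inr ` pverts H) \<times> (Inl ` pverts G) \<rparr>"

definition complete_graph :: "nat \<Rightarrow> nat pair_pre_digraph" where
  "complete_graph r = \<lparr> pverts = {..<r}, parcs = {(u, v). u < r \<and> v < r \<and> u \<noteq> v} \<rparr>"

definition edgeless_graph :: "nat \<Rightarrow> nat pair_pre_digraph" where
  "edgeless_graph k = \<lparr> pverts = {..<k}, parcs = {} \<rparr>"

definition generalized_book :: "nat \<Rightarrow> nat \<Rightarrow> (nat + nat) pair_pre_digraph" where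
  "generalized_book r k = graph_join (complete_graph r) (edgeless_graph k)"

text \<open>The complete multipartite graph on \<open>V\<close> whose partite sets are the fibres of \<open>c\<close>.\<close>

definition complete_multipartite :: "'a set \<Rightarrow> ('a \<Rightarrow> 'c) \<Rightarrow> 'a pair_pre_digraph" where
  "complete_multipartite V c =
     \<lparr> pverts = V, parcs = {(u, v). u \<in> V \<and> v \<in> V \<and> c u \<noteq> c v} \<rparr>"

text \<open>
  The residue classes modulo \<open>r\<close> split the \<open>n\<close> vertices into \<open>r\<close> parts which are as equal in
  size as possible; see \<open>turan_part_card\<close> below.
\<close>

definition turan_graph :: "nat \<Rightarrow> nat \<Rightarrow> nat pair_pre_digraph" where
  "turan_graph n r = complete_multipartite {..<n} (\<lambda>v. v mod r)"

lemma turan_part_card: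
  assumes "i < r"
  shows "card {v \<in> {..<n}. v mod r = i} = n div r + (if i < n mod r then 1 else 0)"
proof (induction n)
  case 0
  then show ?case by simp
next
  case (Suc n)
  have "{v \<in> {..<Suc n}. v mod r = i} =
        (if n mod r = i then insert n {v \<in> {..<n}. v mod r = i} else {v \<in> {..<n}. v mod r = i})"
    by (auto simp: less_Suc_eq)
  then have "card {v \<in> {..<Suc n}. v mod r = i} =
        card {v \<in> {..<n}. v mod r = i} + (if n mod r = i then 1 else 0)"
    by simp
  with Suc.IH assms show ?case
    by (auto simp: mod_Suc div_Suc)
qed

subsection \<open>The signless Laplacian spectral radius\<close>

text \<open>
  Matrices are indexed by \<open>{0..<n}\<close>, so the vertices are enumerated first. The enumeration is
  arbitrary: another one conjugates the matrices below by a permutation matrix, which does not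
  change the spectrum.
\<close>

definition vertex_list :: "'a pair_pre_digraph \<Rightarrow> 'a list" where
  "vertex_list G = (SOME xs. distinct xs \<and> set xs = pverts G)"

definition degree_matrix :: "'a pair_pre_digraph \<Rightarrow> complex mat" where
  "degree_matrix G = (let n = card (pverts G); vs = vertex_list G in
     mat n n (\<lambda>(i, j). if i = j then of_nat (out_degree (with_proj G) (vs ! i)) else 0))"

definition adjacency_matrix :: "'a pair_pre_digraph \<Rightarrow> complex mat" where
  "adjacency_matrix G = (let n = card (pverts G); vs = vertex_list G in
     mat n n (\<lambda>(i, j). if (vs ! i, vs ! j) \<in> parcs G then 1 else 0))"

definition signless_laplacian :: "'a pair_pre_digraph \<Rightarrow> complex mat" where
  "signless_laplacian G = degree_matrix G + adjacency_matrix G"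

definition signless_spectral_radius :: "'a pair_pre_digraph \<Rightarrow> real" where
  "signless_spectral_radius G = spectral_radius (signless_laplacian G)"

end

theory Submission
  imports
    "HOL-Analysis.Function_Topology"
    "HOL-Analysis.Summation_Tests"
    "HOL-Analysis.Convex"
    Defs
begin

text \<open>
  Write \<open>q(G)\<close> for the signless Laplacian spectral radius; it is the maximum of the quadratic form
  \<open>\<Sum>\<^bsub>uv \<in> E\<^esub> (x\<^sub>u + x\<^sub>v)\<^sup>2\<close> on the unit sphere, attained at a nonnegative eigenvector. The proof
  compares \<open>q(G)\<close> with \<open>2 (1 - 1/r) n\<close>, which \<open>q(T\<^bsub>n,r\<^esub>)\<close> equals up to an error of at most \<open>2 r / n\<close>, and
  combines three facts.

  \<^item> Deleting a vertex (\<open>qmax_density_increment\<close>). Suppose that \<open>q(G)\<close> is at least about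
    \<open>2 (1 - 1/r) n\<close>, but some degree is below \<open>(1 - 1/r - \<epsilon>) n\<close>. The low degree forces the smallest
    entry of the unit eigenvector to have square at most \<open>(1 - \<epsilon>) / n\<close>, and deleting the vertex of that
    entry then raises \<open>q / n\<close> by a constant multiple of \<open>1 / n\<close>. This is where \<open>r \<ge> 3\<close> matters: the
    gain carries the factor \<open>q / n - 1\<close>, which is close to \<open>1 - 2/r\<close> and vanishes for bipartite graphs.

  \<^item> Stability (\<open>dense_book_free_multipartite\<close>). A large book-free graph all of whose degrees are
    at least \<open>(1 - 1/r - \<epsilon>) n\<close> is \<open>r\<close>-partite. It has no clique on \<open>r + 1\<close> vertices, as many vertices
    would be adjacent to \<open>r\<close> vertices of the clique and yield a book. For a clique on \<open>r\<close> vertices, the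
    vertices adjacent to all of its members but one form \<open>r\<close> classes, and an edge that contradicts
    \<open>r\<close>-partiteness could be completed greedily to a clique on \<open>r + 1\<close> vertices.

  \<^item> Multipartite graphs (\<open>multipartite_shares\<close>, \<open>multipartite_qmax_le_turan\<close>). If the classes have
    sizes \<open>n\<^sub>1, \<dots>, n\<^sub>r\<close> and \<open>p = q - n > 0\<close>, the eigenvalue equation gives \<open>1 \<le> \<Sum>\<^sub>i n\<^sub>i / (p + 2 n\<^sub>i)\<close>, with
    equality exactly for complete multipartite graphs. The summand is strictly concave in \<open>n\<^sub>i\<close> and
    decreasing in \<open>p\<close>, so \<open>q\<close> is largest for balanced classes, and only for them. It also follows that
    \<open>q \<le> 2 (1 - 1/r) n\<close> for every \<open>r\<close>-partite graph.

  Suppose now that \<open>G\<close> is book-free on \<open>n\<close> vertices and \<open>q(G) \<ge> q(T\<^bsub>n,r\<^esub>)\<close>. If a degree were small, one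
  deletion would lead to a graph with \<open>q > 2 (1 - 1/r)\<close> times its order. Such a graph is not
  \<open>r\<close>-partite, so by stability it has a small degree, and the deletion can be repeated. The increments
  of \<open>q / n\<close> form a harmonic series, whereas \<open>q / n \<le> 2\<close>; for large \<open>n\<close> this is impossible
  (\<open>qmax_excess_bound\<close>). So all degrees of \<open>G\<close> are large, \<open>G\<close> is \<open>r\<close>-partite, and the comparison of
  multipartite graphs finishes the proof.
\<close>

section \<open>The quadratic form of the signless Laplacian\<close>

text \<open>
  Graphs are given by a vertex set \<open>V\<close> and an adjacency predicate \<open>E\<close> on the whole type. Passing to an
  induced subgraph then only shrinks \<open>V\<close>, which is convenient for deleting vertices one after another.
\<close>

definition nbrs :: "('a \<Rightarrow> 'a \<Rightarrow> bool) \<Rightarrow> 'a set \<Rightarrow> 'a \<Rightarrow> 'a set" where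
  "nbrs E V u = {v \<in> V. E u v}"

text \<open>
  The entry at \<open>u\<close> of the product of the signless Laplacian with \<open>x\<close>.
\<close>

definition qapply :: "('a \<Rightarrow> 'a \<Rightarrow> bool) \<Rightarrow> 'a set \<Rightarrow> ('a \<Rightarrow> real) \<Rightarrow> 'a \<Rightarrow> real" where
  "qapply E V x u = (\<Sum>v\<in>nbrs E V u. x u + x v)"

definition qform :: "('a \<Rightarrow> 'a \<Rightarrow> bool) \<Rightarrow> 'a set \<Rightarrow> ('a \<Rightarrow> real) \<Rightarrow> real" where
  "qform E V x = (\<Sum>u\<in>V. x u * qapply E V x u)"

definition qmax :: "('a \<Rightarrow> 'a \<Rightarrow> bool) \<Rightarrow> 'a set \<Rightarrow> real" where
  "qmax E V = Sup (qform E V ` {x. (\<Sum>v\<in>V. (x v)\<^sup>2) = 1})"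

locale adjacency =
  fixes E :: "'a \<Rightarrow> 'a \<Rightarrow> bool"
  assumes sym: "E u v \<Longrightarrow> E v u" and irrefl: "\<not> E u u"
begin

lemma finite_nbrs [simp]: "finite V \<Longrightarrow> finite (nbrs E V u)"
  by (simp add: nbrs_def)

lemma qapply_eq: "qapply E V x u = real (card (nbrs E V u)) * x u + (\<Sum>v\<in>nbrs E V u. x v)"
  by (simp add: qapply_def sum.distrib)

lemma qapply_scale: "qapply E V (\<lambda>v. c * x v) u = c * qapply E V x u"
  by (simp add: qapply_def sum_distrib_left distrib_left)

lemma qform_scale: "qform E V (\<lambda>v. c * x v) = c\<^sup>2 * qform E V x"
  by (simp add: qform_def qapply_scale sum_distrib_left power2_eq_square mult_ac)

lemma qform_cong: "(\<And>v. v \<in> V \<Longrightarrow> x v = y v) \<Longrightarrow> qform E V x = qform E V y"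
  unfolding qform_def qapply_def nbrs_def by (intro sum.cong refl arg_cong2[where f="(*)"]) auto

lemma qform_le_abs: "qform E V x \<le> qform E V (\<lambda>v. \<bar>x v\<bar>)"
  unfolding qform_def qapply_def sum_distrib_left
proof (intro sum_mono)
  fix u v
  have "x u * x v \<le> \<bar>x u\<bar> * \<bar>x v\<bar>" by (metis abs_ge_self abs_mult)
  then show "x u * (x u + x v) \<le> \<bar>x u\<bar> * (\<bar>x u\<bar> + \<bar>x v\<bar>)"
    by (simp add: distrib_left)
qed

lemma qapply_symmetric:
  assumes "finite V"
  shows "(\<Sum>u\<in>V. x u * qapply E V y u) = (\<Sum>u\<in>V. y u * qapply E V x u)"
proof -
  have "(\<Sum>u\<in>V. \<Sum>v\<in>nbrs E V u. x u * y v) = (\<Sum>v\<in>V. \<Sum>u | u \<in> V \<and> E u v. x u * y v)"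
    unfolding nbrs_def by (rule sum.swap_restrict) (use assms in auto)
  also have "\<dots> = (\<Sum>u\<in>V. \<Sum>v\<in>nbrs E V u. y u * x v)"
    unfolding nbrs_def by (intro sum.cong) (auto intro: sym simp: mult_ac)
  finally have *: "(\<Sum>u\<in>V. \<Sum>v\<in>nbrs E V u. x u * y v) = (\<Sum>u\<in>V. \<Sum>v\<in>nbrs E V u. y u * x v)" .
  have "(\<Sum>u\<in>V. x u * qapply E V y u) = (\<Sum>u\<in>V. real (card (nbrs E V u)) * x u * y u)
      + (\<Sum>u\<in>V. \<Sum>v\<in>nbrs E V u. x u * y v)" for x y
    unfolding qapply_eq distrib_left sum.distrib sum_distrib_left by (simp add: mult_ac)
  then show ?thesis by (simp add: * mult_ac)
qed

lemma qform_add: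
  assumes "finite V"
  shows "qform E V (\<lambda>v. x v + t * h v)
    = qform E V x + 2 * t * (\<Sum>u\<in>V. h u * qapply E V x u) + t\<^sup>2 * qform E V h"
proof -
  have "qapply E V (\<lambda>v. x v + t * h v) u = qapply E V x u + t * qapply E V h u" for u
    unfolding qapply_def sum_distrib_left by (simp add: sum.distrib[symmetric] algebra_simps)
  then have "qform E V (\<lambda>v. x v + t * h v) = (\<Sum>u\<in>V. x u * qapply E V x u
      + t * (x u * qapply E V h u) + t * (h u * qapply E V x u) + t\<^sup>2 * (h u * qapply E V h u))"
    unfolding qform_def by (intro sum.cong) (auto simp: algebra_simps power2_eq_square)
  also have "\<dots> = qform E V x + t * (\<Sum>u\<in>V. x u * qapply E V h u)
      + t * (\<Sum>u\<in>V. h u * qapply E V x u) + t\<^sup>2 * qform E V h"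
    by (simp only: qform_def sum.distrib sum_distrib_left)
  finally have "qform E V (\<lambda>v. x v + t * h v) = qform E V x + t * (\<Sum>u\<in>V. x u * qapply E V h u)
      + t * (\<Sum>u\<in>V. h u * qapply E V x u) + t\<^sup>2 * qform E V h" .
  then show ?thesis using qapply_symmetric[OF assms, of x h] by simp
qed

text \<open>
  Only the coordinates in \<open>V\<close> matter, so the sphere can be cut down to functions that vanish outside
  \<open>V\<close>. In the product topology these lie in a product of compact intervals.
\<close>

lemma qform_attains_max:
  assumes "finite V" "V \<noteq> {}"
  obtains x where "(\<Sum>v\<in>V. (x v)\<^sup>2) = 1"
    "\<And>y. (\<Sum>v\<in>V. (y v)\<^sup>2) = 1 \<Longrightarrow> qform E V y \<le> qform E V x"
proof -
  define B :: "('a \<Rightarrow> real) set" where "B = Pi\<^sub>E UNIV (\<lambda>i. if i \<in> V then {-1..1} else {0})"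
  define S where "S = B \<inter> {x. (\<Sum>v\<in>V. (x v)\<^sup>2) = 1}"
  have "compactin (product_topology (\<lambda>i. euclidean) UNIV) B"
    unfolding B_def compactin_PiE by auto
  then have "compact B" unfolding euclidean_product_topology by simp
  moreover have "closed {x :: 'a \<Rightarrow> real. (\<Sum>v\<in>V. (x v)\<^sup>2) = 1}"
    by (intro closed_Collect_eq continuous_intros continuous_on_product_coordinates)
  ultimately have "compact S" unfolding S_def by (rule compact_Int_closed)
  obtain w where w: "w \<in> V" using assms by auto
  have "(\<Sum>v\<in>V. (if v = w then 1 else 0 :: real)\<^sup>2) = (\<Sum>v\<in>V. if v = w then 1 else 0)"
    by (intro sum.cong) auto
  then have "(\<lambda>v. if v = w then 1 else 0) \<in> S"
    using w assms by (auto simp: S_def B_def split: if_splits)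
  then have "S \<noteq> {}" by auto
  moreover have "continuous_on S (qform E V)"
    unfolding qform_def qapply_def
    by (intro continuous_intros continuous_on_subset[OF continuous_on_product_coordinates]) auto
  ultimately obtain x where x: "x \<in> S" "\<And>y. y \<in> S \<Longrightarrow> qform E V y \<le> qform E V x"
    using continuous_attains_sup[OF \<open>compact S\<close>] by blast
  have "qform E V y \<le> qform E V x" if y: "(\<Sum>v\<in>V. (y v)\<^sup>2) = 1" for y
  proof -
    define y' where "y' = (\<lambda>v. if v \<in> V then y v else 0)"
    have "\<bar>y v\<bar> \<le> 1" if "v \<in> V" for v
    proof -
      have "(y v)\<^sup>2 \<le> 1" using y member_le_sum[OF that, of "\<lambda>v. (y v)\<^sup>2"] assms by simp
      then show ?thesis by (simp add: abs_square_le_1)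
    qed
    then have "y' \<in> S" using y by (auto simp: S_def B_def y'_def abs_le_iff minus_le_iff)
    moreover have "qform E V y' = qform E V y" by (rule qform_cong) (simp add: y'_def)
    ultimately show ?thesis using x(2) by force
  qed
  then show ?thesis using that x(1) by (auto simp: S_def)
qed

lemma qform_le_qmax:
  assumes "finite V"
  shows "qform E V x \<le> qmax E V * (\<Sum>v\<in>V. (x v)\<^sup>2)"
proof (cases "(\<Sum>v\<in>V. (x v)\<^sup>2) = 0")
  case True
  then have "\<forall>v\<in>V. x v = 0" using assms by (simp add: sum_nonneg_eq_0_iff)
  then show ?thesis using True by (simp add: qform_def)
next
  case False
  then have "V \<noteq> {}" by auto
  obtain z where z: "(\<Sum>v\<in>V. (z v)\<^sup>2) = 1"
    "\<And>y. (\<Sum>v\<in>V. (y v)\<^sup>2) = 1 \<Longrightarrow> qform E V y \<le> qform E V z"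
    using qform_attains_max[OF assms \<open>V \<noteq> {}\<close>] by blast
  define s where "s = (\<Sum>v\<in>V. (x v)\<^sup>2)"
  have "s > 0" using False by (simp add: s_def order_less_le sum_nonneg)
  define y where "y = (\<lambda>v. (1 / sqrt s) * x v)"
  have "(\<Sum>v\<in>V. (y v)\<^sup>2) = s / s"
    using \<open>s > 0\<close> unfolding y_def power_mult_distrib sum_distrib_left[symmetric] s_def[symmetric]
    by (simp add: power_divide)
  then have "(\<Sum>v\<in>V. (y v)\<^sup>2) = 1" using \<open>s > 0\<close> by simp
  then have "qform E V y \<le> qmax E V"
    unfolding qmax_def by (intro cSup_upper bdd_aboveI[of _ "qform E V z"]) (use z in auto)
  moreover have "qform E V y = qform E V x / s"
    using \<open>s > 0\<close> by (simp only: y_def qform_scale) (simp add: power_divide)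
  ultimately show ?thesis using \<open>s > 0\<close> by (simp add: s_def[symmetric] field_simps)
qed

text \<open>
  Replacing a maximizer by its absolute values does not decrease the form, as the matrix has nonnegative
  entries. A maximizer on the sphere is an eigenvector because the form can be varied in each single
  coordinate.
\<close>

lemma qmax_eigenvector:
  assumes "finite V" "V \<noteq> {}"
  obtains x where "\<And>v. x v \<ge> 0" "(\<Sum>v\<in>V. (x v)\<^sup>2) = 1"
    "\<And>u. u \<in> V \<Longrightarrow> qapply E V x u = qmax E V * x u" "qform E V x = qmax E V"
proof -
  obtain z where z: "(\<Sum>v\<in>V. (z v)\<^sup>2) = 1"
    "\<And>y. (\<Sum>v\<in>V. (y v)\<^sup>2) = 1 \<Longrightarrow> qform E V y \<le> qform E V z"
    using qform_attains_max[OF assms] by blast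
  define x where "x = (\<lambda>v. \<bar>z v\<bar>)"
  have x1: "(\<Sum>v\<in>V. (x v)\<^sup>2) = 1" using z(1) by (simp add: x_def)
  have q: "qform E V x = qmax E V"
  proof (rule antisym)
    show "qform E V x \<le> qmax E V" using qform_le_qmax[OF assms(1), of x] x1 by simp
    show "qmax E V \<le> qform E V x"
      unfolding qmax_def
    proof (intro cSup_least)
      fix a assume "a \<in> qform E V ` {x. (\<Sum>v\<in>V. (x v)\<^sup>2) = 1}"
      then have "a \<le> qform E V z" using z(2) by auto
      then show "a \<le> qform E V x" using qform_le_abs[of V z] by (simp add: x_def)
    qed (use z(1) in auto)
  qed
  have "qapply E V x u = qmax E V * x u" if u: "u \<in> V" for u
  proof (rule ccontr)
    assume ne: "\<not> ?thesis"
    define h where "h = (\<lambda>v. if v = u then 1 else 0 :: real)"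
    define b where "b = qapply E V x u - qmax E V * x u"
    define c where "c = qform E V h - qmax E V"
    have ineq: "2 * t * b + t\<^sup>2 * c \<le> 0" for t
    proof -
      have "qform E V (\<lambda>v. x v + t * h v) \<le> qmax E V * (\<Sum>v\<in>V. (x v + t * h v)\<^sup>2)"
        by (rule qform_le_qmax[OF assms(1)])
      moreover have "(\<Sum>v\<in>V. (x v + t * h v)\<^sup>2) = 1 + 2 * t * x u + t\<^sup>2"
      proof -
        have "(\<Sum>v\<in>V. (x v + t * h v)\<^sup>2)
            = (\<Sum>v\<in>V. (x v)\<^sup>2) + (\<Sum>v\<in>V. if v = u then 2 * t * x u + t\<^sup>2 else 0)"
          unfolding sum.distrib[symmetric]
          by (intro sum.cong) (auto simp: h_def power2_sum)
        then show ?thesis using u assms x1 by simp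
      qed
      moreover have "(\<Sum>v\<in>V. h v * qapply E V x v) = qapply E V x u"
        using u assms by (simp add: h_def if_distrib[of "\<lambda>c. c * _"] cong: if_cong)
      ultimately show ?thesis
        by (simp add: qform_add[OF assms(1)] q b_def c_def algebra_simps)
    qed
    have "b \<noteq> 0" using ne by (simp add: b_def)
    \<comment> \<open>a step of length \<open>b / p\<close> is so short that the linear term dominates the quadratic one\<close>
    define p where "p = \<bar>c\<bar> + 1"
    have p: "p > 0" "c > - p" by (auto simp: p_def)
    have "2 * (b / p) * b + (b / p)\<^sup>2 * c = b\<^sup>2 / p\<^sup>2 * (2 * p + c)"
      using p by (simp add: power2_eq_square field_simps)
    also have "\<dots> > 0" using p \<open>b \<noteq> 0\<close> by (intro mult_pos_pos) auto
    finally show False using ineq[of "b / p"] by simp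
  qed
  then show ?thesis using that[of x] q x1 by (simp add: x_def)
qed

lemma qmax_nonneg:
  assumes "finite V" "V \<noteq> {}" shows "qmax E V \<ge> 0"
proof -
  obtain x where x: "\<And>v. x v \<ge> 0" "(\<Sum>v\<in>V. (x v)\<^sup>2) = 1"
    "\<And>u. u \<in> V \<Longrightarrow> qapply E V x u = qmax E V * x u" "qform E V x = qmax E V"
    by (rule qmax_eigenvector[OF assms]) (rule that)
  have "qform E V x \<ge> 0"
    unfolding qform_def qapply_def by (intro sum_nonneg mult_nonneg_nonneg add_nonneg_nonneg x)
  then show ?thesis using x(4) by simp
qed

text \<open>
  The eigenvalue equation at a vertex of largest entry bounds \<open>q\<close> by twice the degree of that vertex.
\<close>

lemma qmax_le_twice_card:
  assumes "finite V" "V \<noteq> {}" shows "qmax E V \<le> 2 * real (card V)"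
proof -
  obtain x where x: "\<And>v. x v \<ge> 0" "(\<Sum>v\<in>V. (x v)\<^sup>2) = 1"
    "\<And>u. u \<in> V \<Longrightarrow> qapply E V x u = qmax E V * x u" "qform E V x = qmax E V"
    by (rule qmax_eigenvector[OF assms]) (rule that)
  have "Max (x ` V) \<in> x ` V" using assms by (intro Max_in) auto
  then obtain u where u0: "u \<in> V" "x u = Max (x ` V)" by auto
  have u: "u \<in> V" "\<And>v. v \<in> V \<Longrightarrow> x v \<le> x u" using u0 assms by auto
  have "x u \<noteq> 0"
  proof
    assume "x u = 0"
    then have "\<forall>v\<in>V. x v = 0" using u x(1) by (metis order_antisym)
    then show False using x(2) by simp
  qed
  then have pos: "x u > 0" using x(1)[of u] by simp
  have "qmax E V * x u = (\<Sum>v\<in>nbrs E V u. x u + x v)" using x(3)[OF u(1)] by (simp add: qapply_def)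
  also have "\<dots> \<le> (\<Sum>v\<in>nbrs E V u. 2 * x u)" by (rule sum_mono) (use u in \<open>auto simp: nbrs_def\<close>)
  also have "\<dots> \<le> (2 * real (card V)) * x u"
    using pos card_mono[OF assms(1), of "nbrs E V u"] by (simp add: nbrs_def)
  finally show ?thesis using pos by simp
qed

end

lemma pair_graph_adjacency:
  assumes "pair_graph G" shows "adjacency (\<lambda>u v. (u, v) \<in> parcs G)"
proof -
  interpret pair_graph G by fact
  show ?thesis
    by unfold_locales (auto dest: no_loops' arcs_symmetric)
qed

lemma out_degree_eq_card_nbrs:
  assumes "pair_wf_digraph G"
  shows "out_degree (with_proj G) u = card (nbrs (\<lambda>u v. (u, v) \<in> parcs G) (pverts G) u)"
proof -
  interpret pair_wf_digraph G by fact
  have "out_arcs (with_proj G) u = Pair u ` nbrs (\<lambda>u v. (u, v) \<in> parcs G) (pverts G) u"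
    by (auto simp: out_arcs_def nbrs_def dest: in_arcsD2)
  then show ?thesis by (simp add: out_degree_def card_image inj_on_def)
qed

lemma vertex_list:
  assumes "finite (pverts G)"
  shows "distinct (vertex_list G)" "set (vertex_list G) = pverts G"
    "length (vertex_list G) = card (pverts G)"
proof -
  have "\<exists>xs. distinct xs \<and> set xs = pverts G" using finite_distinct_list[OF assms] by blast
  from someI_ex[OF this] show "distinct (vertex_list G)" "set (vertex_list G) = pverts G"
    by (auto simp: vertex_list_def)
  then show "length (vertex_list G) = card (pverts G)" by (metis distinct_card)
qed

lemma signless_laplacian_mult_vec:
  fixes z :: "'a \<Rightarrow> complex"
  assumes "pair_graph G" and i: "i < card (pverts G)"
  defines "E \<equiv> \<lambda>u v. (u, v) \<in> parcs G" and "u \<equiv> vertex_list G ! i"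
  shows "(signless_laplacian G *\<^sub>v vec (card (pverts G)) (\<lambda>j. z (vertex_list G ! j))) $ i
    = (\<Sum>v\<in>nbrs E (pverts G) u. z u + z v)"
proof -
  interpret pair_graph G by fact
  define n where "n = card (pverts G)"
  define vs where "vs = vertex_list G"
  note vs = vertex_list[OF pair_finite_verts, folded vs_def n_def]
  have reindex: "(\<Sum>j = 0..<n. f (vs ! j)) = (\<Sum>v\<in>pverts G. f v)" for f :: "'a \<Rightarrow> complex"
  proof -
    have "bij_betw ((!) vs) {0..<n} (pverts G)" using bij_betw_nth[of vs "{..<n}"] vs by (simp add: atLeast0LessThan)
    then show ?thesis by (rule sum.reindex_bij_betw)
  qed
  have "(signless_laplacian G *\<^sub>v vec n (\<lambda>j. z (vs ! j))) $ i
      = (\<Sum>j = 0..<n. ((if i = j then of_nat (out_degree (with_proj G) (vs ! i)) else 0) +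
          (if (vs ! i, vs ! j) \<in> parcs G then 1 else 0)) * z (vs ! j))"
    using i unfolding n_def[symmetric]
    by (simp add: signless_laplacian_def degree_matrix_def adjacency_matrix_def Let_def
        n_def[symmetric] vs_def[symmetric] scalar_prod_def)
  also have "\<dots> = of_nat (out_degree (with_proj G) (vs ! i)) * z (vs ! i)
      + (\<Sum>j = 0..<n. (if (vs ! i, vs ! j) \<in> parcs G then 1 else 0) * z (vs ! j))"
    using i unfolding n_def[symmetric]
    by (simp add: distrib_right sum.distrib if_distrib[of "\<lambda>c. c * _"] cong: if_cong)
  also have "\<dots> = of_nat (card (nbrs E (pverts G) u)) * z u + (\<Sum>v\<in>nbrs E (pverts G) u. z v)"
    unfolding reindex[of "\<lambda>v. (if (vs ! i, v) \<in> parcs G then 1 else 0) * z v"]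
    using out_degree_eq_card_nbrs[of G] pair_wf_digraph pair_finite_verts
    by (simp add: u_def vs_def[symmetric] E_def[symmetric] if_distrib[of "\<lambda>c. c * _"] nbrs_def
        sum.inter_filter cong: if_cong) (simp add: E_def)
  finally show ?thesis by (simp add: sum.distrib n_def vs_def)
qed

text \<open>
  For a complex eigenvector \<open>z\<close> with eigenvalue \<open>k\<close>, the triangle inequality gives
  \<open>\<bar>k\<bar> \<bar>z\<bar> \<le> Q \<bar>z\<bar>\<close> entrywise, and pairing with \<open>\<bar>z\<bar>\<close> bounds \<open>\<bar>k\<bar>\<close> by the maximum of the form. In the
  other direction, the real eigenvector of the maximum is also a complex one.
\<close>

lemma signless_spectral_radius_eq_qmax:
  assumes "pair_graph G" and ne: "pverts G \<noteq> {}"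
  shows "signless_spectral_radius G = qmax (\<lambda>u v. (u, v) \<in> parcs G) (pverts G)"
proof -
  interpret pair_graph G by fact
  define V where "V = pverts G"
  define E where "E = (\<lambda>u v. (u, v) \<in> parcs G)"
  define M where "M = signless_laplacian G"
  define n where "n = card V"
  define vs where "vs = vertex_list G"
  interpret adjacency E unfolding E_def by (rule pair_graph_adjacency) fact
  have fin: "finite V" "V \<noteq> {}" using pair_finite_verts ne by (auto simp: V_def)
  then have n: "n > 0" by (simp add: n_def card_gt_0_iff)
  note vs = vertex_list[OF pair_finite_verts, folded vs_def V_def n_def]
  have M: "M \<in> carrier_mat n n"
    by (simp add: M_def signless_laplacian_def degree_matrix_def adjacency_matrix_def Let_def
        n_def V_def)
  have mult: "(M *\<^sub>v vec n (\<lambda>j. z (vs ! j))) $ i = (\<Sum>v\<in>nbrs E V (vs ! i). z (vs ! i) + z v)"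
    if "i < n" for z i
    using signless_laplacian_mult_vec[OF assms(1), of i z] that
    by (simp add: M_def V_def E_def n_def vs_def)
  have "spectral_radius M \<le> qmax E V"
  proof -
    obtain k where k: "k \<in> spectrum M" "cmod k = spectral_radius M"
      using spectral_radius_mem_max(1)[OF M n] by auto
    then obtain w where w: "w \<in> carrier_vec n" "w \<noteq> 0\<^sub>v n" "M *\<^sub>v w = k \<cdot>\<^sub>v w"
      using M by (auto simp: spectrum_def eigenvalue_def eigenvector_def)
    \<comment> \<open>the eigenvector as a function of the vertices rather than of their positions in the list\<close>
    define z where "z = (\<lambda>v. w $ (the_inv_into {0..<n} ((!) vs) v))"
    have inj: "inj_on ((!) vs) {0..<n}" using vs by (auto simp: inj_on_def nth_eq_iff_index_eq)
    have z: "z (vs ! j) = w $ j" if "j < n" for j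
      using that the_inv_into_f_f[OF inj] by (simp add: z_def)
    have w_eq: "w = vec n (\<lambda>j. z (vs ! j))"
      using w(1) z by (intro eq_vecI) auto
    have eq: "k * z u = (\<Sum>v\<in>nbrs E V u. z u + z v)" if u: "u \<in> V" for u
    proof -
      obtain i where i: "i < n" "u = vs ! i" using u vs(2,3) in_set_conv_nth[of u vs] by auto
      have "(M *\<^sub>v w) $ i = k * z u" using w i z by simp
      then show ?thesis using mult[OF i(1), of z] i(2) unfolding w_eq[symmetric] by simp
    qed
    define x where "x = (\<lambda>v. cmod (z v))"
    have le: "cmod k * x u \<le> qapply E V x u" if "u \<in> V" for u
    proof -
      have "cmod k * x u = cmod (\<Sum>v\<in>nbrs E V u. z u + z v)"
        using eq[OF that] by (simp add: x_def norm_mult[symmetric])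
      also have "\<dots> \<le> (\<Sum>v\<in>nbrs E V u. x u + x v)"
        unfolding x_def by (intro sum_norm_le norm_triangle_ineq)
      finally show ?thesis by (simp add: qapply_def)
    qed
    have "cmod k * (\<Sum>v\<in>V. (x v)\<^sup>2) \<le> qform E V x"
      unfolding qform_def sum_distrib_left
    proof (intro sum_mono)
      fix u assume "u \<in> V"
      from mult_left_mono[OF le[OF this], of "x u"]
      show "cmod k * (x u)\<^sup>2 \<le> x u * qapply E V x u"
        by (simp add: x_def power2_eq_square mult_ac)
    qed
    also have "\<dots> \<le> qmax E V * (\<Sum>v\<in>V. (x v)\<^sup>2)" by (rule qform_le_qmax[OF fin(1)])
    finally have "cmod k * (\<Sum>v\<in>V. (x v)\<^sup>2) \<le> qmax E V * (\<Sum>v\<in>V. (x v)\<^sup>2)" .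
    moreover have "(\<Sum>v\<in>V. (x v)\<^sup>2) > 0"
    proof -
      obtain j where "j < n" "w $ j \<noteq> 0" using w(1,2) eq_vecI[of w "0\<^sub>v n"] by auto
      then have "vs ! j \<in> V" "x (vs ! j) \<noteq> 0" using vs z by (auto simp: x_def)
      then show ?thesis using fin by (intro sum_pos2[of _ "vs ! j"]) auto
    qed
    ultimately show ?thesis using k(2) by simp
  qed
  moreover have "qmax E V \<le> spectral_radius M"
  proof -
    obtain x where x: "\<And>v. x v \<ge> 0" "(\<Sum>v\<in>V. (x v)\<^sup>2) = 1"
      "\<And>u. u \<in> V \<Longrightarrow> qapply E V x u = qmax E V * x u" "qform E V x = qmax E V"
      by (rule qmax_eigenvector[OF fin]) (rule that)
    define w where "w = vec n (\<lambda>j. complex_of_real (x (vs ! j)))"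
    have "M *\<^sub>v w = complex_of_real (qmax E V) \<cdot>\<^sub>v w"
    proof (rule eq_vecI)
      fix i assume "i < dim_vec (complex_of_real (qmax E V) \<cdot>\<^sub>v w)"
      then have i: "i < n" by (simp add: w_def)
      then have u: "vs ! i \<in> V" using vs by auto
      have "(M *\<^sub>v w) $ i = complex_of_real (qapply E V x (vs ! i))"
        unfolding w_def mult[OF i, of "\<lambda>v. complex_of_real (x v)"] by (simp add: qapply_def)
      then show "(M *\<^sub>v w) $ i = (complex_of_real (qmax E V) \<cdot>\<^sub>v w) $ i"
        using i x(3)[OF u] by (simp add: w_def)
    qed (use M in \<open>simp add: w_def\<close>)
    moreover have "w \<noteq> 0\<^sub>v n"
    proof
      assume "w = 0\<^sub>v n"
      have "x v = 0" if v: "v \<in> V" for v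
      proof -
        obtain i where "i < n" "v = vs ! i" using v vs(2,3) in_set_conv_nth[of v vs] by auto
        then show ?thesis using \<open>w = 0\<^sub>v n\<close> index_vec[of i n "\<lambda>j. complex_of_real (x (vs ! j))"]
            by (simp add: w_def)
      qed
      then show False using x(2) by simp
    qed
    moreover have "w \<in> carrier_vec n" by (simp add: w_def)
    ultimately have "complex_of_real (qmax E V) \<in> spectrum M"
      using M by (auto simp: spectrum_def eigenvalue_def eigenvector_def)
    then have "cmod (complex_of_real (qmax E V)) \<le> spectral_radius M"
      using spectral_radius_mem_max(2)[OF M n] by blast
    then show ?thesis using qmax_nonneg[OF fin] by simp
  qed
  ultimately show ?thesis by (simp add: signless_spectral_radius_def M_def V_def E_def)
qed

section \<open>Deleting a vertex\<close>

context adjacency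
begin

lemma qform_delete:
  assumes "finite V" "u \<in> V"
  shows "qform E V x = qform E (V - {u}) x + (\<Sum>v\<in>nbrs E V u. (x u + x v)\<^sup>2)"
proof -
  have qa: "qapply E V x w = qapply E (V - {u}) x w + (if E w u then x w + x u else 0)" for w
  proof -
    have "nbrs E V w = (if E w u then insert u (nbrs E (V - {u}) w) else nbrs E (V - {u}) w)"
      using assms(2) by (auto simp: nbrs_def)
    moreover have "u \<notin> nbrs E (V - {u}) w" by (simp add: nbrs_def)
    ultimately show ?thesis using assms(1) by (simp add: qapply_def algebra_simps)
  qed
  have N: "nbrs E V u = {w \<in> V - {u}. E w u}" using irrefl sym by (auto simp: nbrs_def)
  have "qform E V x = x u * qapply E V x u + (\<Sum>w\<in>V - {u}. x w * qapply E V x w)"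
    using assms by (simp add: qform_def sum.remove)
  also have "(\<Sum>w\<in>V - {u}. x w * qapply E V x w) = qform E (V - {u}) x
      + (\<Sum>w\<in>V - {u}. if E w u then x w * (x w + x u) else 0)"
    unfolding qform_def sum.distrib[symmetric] by (intro sum.cong) (auto simp: qa distrib_left)
  also have "(\<Sum>w\<in>V - {u}. if E w u then x w * (x w + x u) else 0)
      = (\<Sum>w\<in>nbrs E V u. x w * (x w + x u))"
    unfolding N using assms(1) by (subst sum.inter_filter) auto
  also have "x u * qapply E V x u = (\<Sum>w\<in>nbrs E V u. x u * (x u + x w))"
    by (simp only: qapply_def sum_distrib_left)
  finally have *: "qform E V x = (\<Sum>w\<in>nbrs E V u. x u * (x u + x w)) + (qform E (V - {u}) x
      + (\<Sum>w\<in>nbrs E V u. x w * (x w + x u)))" .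
  have "(\<Sum>v\<in>nbrs E V u. (x u + x v)\<^sup>2)
      = (\<Sum>w\<in>nbrs E V u. x u * (x u + x w)) + (\<Sum>w\<in>nbrs E V u. x w * (x w + x u))"
    unfolding sum.distrib[symmetric] by (intro sum.cong) (auto simp: power2_eq_square algebra_simps)
  then show ?thesis using * by simp
qed

text \<open>
  Here \<open>y\<close> is the square of the smallest entry of the unit eigenvector \<open>x\<close>, and \<open>u\<close> is its vertex. The
  restriction of \<open>x\<close> to the other vertices is a test vector for the smaller graph. The edges at \<open>u\<close>
  contribute \<open>d y + 2 (q - d) y\<close> plus the squares of the entries at the neighbours of \<open>u\<close>, where \<open>d\<close>
  is its degree; those squares sum to at most \<open>1 - (m - d) y\<close>, as every entry outside the neighbourhood
  has square at least \<open>y\<close>. The last inequality says that a vertex \<open>w\<close> of small degree makes \<open>y\<close> small: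
  apply the Cauchy-Schwarz inequality to the eigenvalue equation at \<open>w\<close>.
\<close>

lemma qmax_delete_min_entry:
  assumes fin: "finite V" and ne: "V \<noteq> {}"
  defines "m \<equiv> real (card V)" and "q \<equiv> qmax E V"
  obtains u y where "u \<in> V" "0 \<le> y" "m * y \<le> 1"
    "q * (1 - 2 * y) + m * y - 1 \<le> qmax E (V - {u}) * (1 - y)"
    "\<And>w. w \<in> V \<Longrightarrow> y * (q\<^sup>2 - 2 * q * real (card (nbrs E V w)) + m * real (card (nbrs E V w)))
      \<le> real (card (nbrs E V w))"
proof -
  obtain x where x: "\<And>v. x v \<ge> 0" "(\<Sum>v\<in>V. (x v)\<^sup>2) = 1"
    "\<And>u. u \<in> V \<Longrightarrow> qapply E V x u = qmax E V * x u" "qform E V x = qmax E V"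
    by (rule qmax_eigenvector[OF fin ne]) (rule that)
  have "Min (x ` V) \<in> x ` V" using fin ne by (intro Min_in) auto
  then obtain u where u0: "u \<in> V" "x u = Min (x ` V)" by auto
  have u: "u \<in> V" "\<And>v. v \<in> V \<Longrightarrow> x u \<le> x v" using u0 fin by auto
  define y where "y = (x u)\<^sup>2"
  have y: "y \<le> (x v)\<^sup>2" if "v \<in> V" for v
    using u(2)[OF that] x(1) by (simp add: y_def power_mono)
  define d where "d = (\<lambda>w. real (card (nbrs E V w)))"
  have squares: "(\<Sum>v\<in>nbrs E V w. (x v)\<^sup>2) \<le> 1 - (m - d w) * y" for w
  proof -
    have sub: "nbrs E V w \<subseteq> V" by (auto simp: nbrs_def)
    have "(m - d w) * y = (\<Sum>v\<in>V - nbrs E V w. y)"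
      using card_Diff_subset[OF _ sub] card_mono[OF fin sub] fin
      by (simp add: m_def d_def of_nat_diff)
    also have "\<dots> \<le> (\<Sum>v\<in>V - nbrs E V w. (x v)\<^sup>2)" by (rule sum_mono) (use y in auto)
    also have "\<dots> = 1 - (\<Sum>v\<in>nbrs E V w. (x v)\<^sup>2)"
      using x(2) sum.subset_diff[OF sub fin, of "\<lambda>v. (x v)\<^sup>2"] by simp
    finally show ?thesis by simp
  qed
  have nbr_sum: "(\<Sum>v\<in>nbrs E V w. x v) = (q - d w) * x w" if "w \<in> V" for w
    using x(3)[OF that] by (simp add: qapply_eq q_def d_def algebra_simps)
  show ?thesis
  proof (rule that[of u y])
    show "u \<in> V" "0 \<le> y" using u by (auto simp: y_def)
    have "m * y = (\<Sum>v\<in>V. y)" by (simp add: m_def)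
    also have "\<dots> \<le> 1" unfolding x(2)[symmetric] by (rule sum_mono) (use y in auto)
    finally show "m * y \<le> 1" .
  next
    have "(\<Sum>v\<in>nbrs E V u. (x u + x v)\<^sup>2)
        = d u * y + 2 * x u * (\<Sum>v\<in>nbrs E V u. x v) + (\<Sum>v\<in>nbrs E V u. (x v)\<^sup>2)"
      unfolding power2_sum by (simp add: sum.distrib sum_distrib_left d_def y_def mult_ac)
    also have "\<dots> \<le> d u * y + 2 * (q - d u) * y + (1 - (m - d u) * y)"
      using squares[of u] nbr_sum[OF u(1)] by (simp add: y_def power2_eq_square mult_ac)
    finally have "(\<Sum>v\<in>nbrs E V u. (x u + x v)\<^sup>2) \<le> 2 * q * y + 1 - m * y"
      by (simp add: algebra_simps)
    moreover have "qform E (V - {u}) x \<le> qmax E (V - {u}) * (1 - y)"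
    proof -
      have "(\<Sum>v\<in>V - {u}. (x v)\<^sup>2) = 1 - y" using x(2) u(1) fin by (simp add: y_def sum_diff1)
      then show ?thesis using qform_le_qmax[of "V - {u}" x] fin by simp
    qed
    ultimately show "q * (1 - 2 * y) + m * y - 1 \<le> qmax E (V - {u}) * (1 - y)"
      using qform_delete[OF fin u(1), of x] x(4) by (simp add: q_def algebra_simps)
  next
    fix w assume w: "w \<in> V"
    have "(q - d w)\<^sup>2 * y \<le> (q - d w)\<^sup>2 * (x w)\<^sup>2" by (intro mult_left_mono y w) auto
    also have "\<dots> = (\<Sum>v\<in>nbrs E V w. x v)\<^sup>2" by (simp add: nbr_sum[OF w] power_mult_distrib)
    also have "\<dots> \<le> d w * (\<Sum>v\<in>nbrs E V w. (x v)\<^sup>2)"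
      using sum_squared_le_sum_of_squares[of x "nbrs E V w"] by (simp add: d_def mult.commute)
    also have "\<dots> \<le> d w * (1 - (m - d w) * y)" by (intro mult_left_mono squares) (simp add: d_def)
    finally show "y * (q\<^sup>2 - 2 * q * real (card (nbrs E V w)) + m * real (card (nbrs E V w)))
      \<le> real (card (nbrs E V w))"
      by (simp add: d_def power2_eq_square algebra_simps)
  qed
qed

text \<open>
  Put \<open>\<rho> = q / m\<close> and \<open>Y = m y\<close> with \<open>y\<close> as in \<open>qmax_delete_min_entry\<close>. The low degree forces
  \<open>1 - Y \<ge> \<epsilon>\<close>, and the inequality for the deletion says that \<open>q\<close> of the smaller graph, times \<open>1 - y\<close>,
  is at least \<open>\<rho> (m - 1) (1 - y) + (\<rho> - 1) (1 - Y) - \<rho> y\<close>. The excess \<open>(\<rho> - 1) (1 - Y) \<ge> \<epsilon> / 6\<close> is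
  at least twice the error term \<open>\<rho> y \<le> 2 / m \<le> \<epsilon> / 12\<close>, and the rest is the increment.
\<close>

lemma qmax_density_increment:
  assumes fin: "finite V" and w: "w \<in> V"
    and \<epsilon>: "0 < \<epsilon>" "\<epsilon> \<le> 1/6" and a: "2/3 \<le> a" "a \<le> 1"
    and q: "qmax E V \<ge> (2 * a - \<epsilon>) * real (card V)"
    and deg: "real (card (nbrs E V w)) \<le> (a - \<epsilon>) * real (card V)"
    and large: "real (card V) \<ge> 24 / \<epsilon>"
  shows "\<exists>u\<in>V. qmax E (V - {u})
    \<ge> (qmax E V / real (card V) + \<epsilon> / (12 * real (card V))) * (real (card V) - 1)"
proof -
  define m where "m = real (card V)"
  define Q where "Q = qmax E V"
  define d where "d = real (card (nbrs E V w))"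
  have ne: "V \<noteq> {}" using w by auto
  obtain u y where u: "u \<in> V" and y: "0 \<le> y" "m * y \<le> 1"
    and gain: "Q * (1 - 2 * y) + m * y - 1 \<le> qmax E (V - {u}) * (1 - y)"
    and "\<And>w. w \<in> V \<Longrightarrow> y * (Q\<^sup>2 - 2 * Q * real (card (nbrs E V w)) + m * real (card (nbrs E V w)))
      \<le> real (card (nbrs E V w))"
    by (rule qmax_delete_min_entry[OF fin ne, folded m_def Q_def]) (rule that)
  then have small: "y * (Q\<^sup>2 - 2 * Q * d + m * d) \<le> d" using w by (simp add: d_def)
  have m: "m * \<epsilon> \<ge> 24" using large \<epsilon> by (simp add: m_def field_simps)
  have "m \<ge> 24"
  proof -
    have "m * \<epsilon> \<le> m * 1" using \<epsilon> by (intro mult_left_mono) (auto simp: m_def)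
    then show ?thesis using m by simp
  qed
  have d: "d \<ge> 0" "d \<le> (a - \<epsilon>) * m" using deg by (auto simp: d_def m_def)
  have "(2 * a - \<epsilon>) * m \<ge> 7 / 6 * m" using \<epsilon> a \<open>m \<ge> 24\<close> by (intro mult_right_mono) auto
  then have Q: "Q \<ge> 7 / 6 * m" using q by (simp add: Q_def m_def)
  have Q2: "Q \<le> 2 * m" using qmax_le_twice_card[OF fin ne] by (simp add: Q_def m_def)
  define Y where "Y = m * y"
  have Y: "1 - Y \<ge> \<epsilon>"
  proof -
    have "Q - 2 * d \<ge> \<epsilon> * m" using d q by (simp add: Q_def m_def algebra_simps)
    then have "Q * (Q - 2 * d) \<ge> m * (\<epsilon> * m)" using Q \<open>m \<ge> 24\<close> \<epsilon> by (intro mult_mono) auto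
    then have "y * (m * (\<epsilon> * m) + m * d) \<le> y * (Q\<^sup>2 - 2 * Q * d + m * d)"
      using y by (intro mult_left_mono) (auto simp: power2_eq_square algebra_simps)
    then have "Y * (\<epsilon> * m + d) \<le> d" using small by (simp add: Y_def algebra_simps)
    then have "\<epsilon> * m \<le> (1 - Y) * (\<epsilon> * m + d)" by (simp add: algebra_simps)
    also have "\<dots> \<le> (1 - Y) * m"
    proof (rule mult_left_mono)
      have "\<epsilon> * m + d \<le> a * m" using d by (simp add: algebra_simps)
      also have "\<dots> \<le> 1 * m" using a \<open>m \<ge> 24\<close> by (intro mult_right_mono) auto
      finally show "\<epsilon> * m + d \<le> m" by simp
    qed (use y in \<open>simp add: Y_def\<close>)
    finally show ?thesis using \<open>m \<ge> 24\<close> by simp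
  qed
  define \<rho> where "\<rho> = Q / m"
  have \<rho>: "\<rho> \<ge> 7 / 6" "\<rho> \<le> 2" "Q = \<rho> * m"
    using Q Q2 \<open>m \<ge> 24\<close> by (auto simp: \<rho>_def field_simps)
  have y1: "y \<le> 1 / m" using y \<open>m \<ge> 24\<close> by (simp add: field_simps)
  moreover have "1 / m \<le> \<epsilon> / 24" using m \<open>m \<ge> 24\<close> by (simp add: field_simps)
  ultimately have y2: "y \<le> \<epsilon> / 24" by simp
  have "(\<rho> - 1) * (1 - Y) \<ge> 1 / 6 * \<epsilon>" using \<rho> Y \<epsilon> by (intro mult_mono) auto
  moreover have "\<rho> * y \<le> 2 * (\<epsilon> / 24)" using \<rho> y y2 by (intro mult_mono) auto
  moreover have "\<epsilon> / (12 * m) * (m - 1) * (1 - y) \<le> \<epsilon> / 12"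
  proof -
    have "(m - 1) * (1 - y) \<le> m * 1" using \<open>m \<ge> 24\<close> y y2 \<epsilon> by (intro mult_mono) auto
    then have "\<epsilon> / (12 * m) * ((m - 1) * (1 - y)) \<le> \<epsilon> / (12 * m) * m"
      using \<epsilon> \<open>m \<ge> 24\<close> by (intro mult_left_mono) auto
    then show ?thesis using \<open>m \<ge> 24\<close> by (simp add: mult.assoc)
  qed
  ultimately have "(\<rho> + \<epsilon> / (12 * m)) * (m - 1) * (1 - y)
      \<le> \<rho> * (m - 1) * (1 - y) + (\<rho> - 1) * (1 - Y) - \<rho> * y"
    unfolding distrib_right[of \<rho>] distrib_right[of "\<rho> * (m - 1)"] by linarith
  also have "\<dots> = Q * (1 - 2 * y) + m * y - 1" by (simp add: \<rho>(3) Y_def algebra_simps)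
  also have "\<dots> \<le> qmax E (V - {u}) * (1 - y)" by (rule gain)
  finally have "(\<rho> + \<epsilon> / (12 * m)) * (m - 1) \<le> qmax E (V - {u})"
    using y2 \<epsilon> by simp
  then show ?thesis unfolding \<rho>_def Q_def m_def by (rule bexI[OF _ u])
qed

end

section \<open>Dense book-free graphs are multipartite\<close>

definition clique :: "('a \<Rightarrow> 'a \<Rightarrow> bool) \<Rightarrow> 'a set \<Rightarrow> bool" where
  "clique E K \<longleftrightarrow> (\<forall>u\<in>K. \<forall>v\<in>K. u \<noteq> v \<longrightarrow> E u v)"

definition contains_book :: "('a \<Rightarrow> 'a \<Rightarrow> bool) \<Rightarrow> 'a set \<Rightarrow> nat \<Rightarrow> nat \<Rightarrow> bool" where
  "contains_book E V r k \<longleftrightarrow> (\<exists>K C. K \<subseteq> V \<and> card K = r \<and> clique E K \<and>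
     C \<subseteq> V \<and> card C = k \<and> (\<forall>u\<in>K. \<forall>v\<in>C. E u v))"

lemma contains_book_mono:
  assumes "contains_book E W r k" "W \<subseteq> V"
  shows "contains_book E V r k"
proof -
  obtain K C where "K \<subseteq> W" "card K = r" "clique E K" "C \<subseteq> W" "card C = k" "\<forall>u\<in>K. \<forall>v\<in>C. E u v"
    using assms(1) unfolding contains_book_def by auto
  then show ?thesis
    using assms(2) unfolding contains_book_def by (intro exI[of _ K] exI[of _ C]) auto
qed

context adjacency
begin

text \<open>
  Greedy choice: each chosen vertex removes at most \<open>D\<close> candidates from each of the remaining sets, so
  sets of more than \<open>(card J - 1) D\<close> elements never run empty.
\<close>

lemma transversal_clique:
  fixes W :: "'i \<Rightarrow> 'a set" and D :: real
  assumes "finite J" "D \<ge> 0"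
    and "\<And>j. j \<in> J \<Longrightarrow> finite (W j)"
    and "\<And>j. j \<in> J \<Longrightarrow> real (card (W j)) > (real (card J) - 1) * D"
    and "\<And>i j w. i \<in> J \<Longrightarrow> j \<in> J \<Longrightarrow> i \<noteq> j \<Longrightarrow> w \<in> W i \<Longrightarrow> real (card {v \<in> W j. \<not> E w v}) \<le> D"
  shows "\<exists>f. (\<forall>j\<in>J. f j \<in> W j) \<and> (\<forall>i\<in>J. \<forall>j\<in>J. i \<noteq> j \<longrightarrow> E (f i) (f j))"
  using assms
proof (induction J arbitrary: W rule: finite_induct)
  case empty
  then show ?case by simp
next
  case (insert j J)
  have cj: "real (card (insert j J)) - 1 = real (card J)" using insert.hyps by simp
  have "real (card (W j)) > real (card J) * D" using insert.prems(3)[of j] cj by simp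
  moreover have "real (card J) * D \<ge> 0" using insert.prems(1) by simp
  ultimately have "card (W j) > 0" by linarith
  then obtain w where w: "w \<in> W j" by (metis card_gt_0_iff equals0I)
  define W' where "W' = (\<lambda>l. {v \<in> W l. E w v})"
  have "\<exists>f. (\<forall>j\<in>J. f j \<in> W' j) \<and> (\<forall>i\<in>J. \<forall>j\<in>J. i \<noteq> j \<longrightarrow> E (f i) (f j))"
  proof (rule insert.IH[OF insert.prems(1)])
    fix l assume l: "l \<in> J"
    then have fin: "finite (W l)" using insert.prems(2) by simp
    then show "finite (W' l)" by (simp add: W'_def)
    have ne: "j \<noteq> l" using l insert.hyps by auto
    have "card (W l) = card (W' l) + card {v \<in> W l. \<not> E w v}"
      unfolding W'_def using fin by (subst card_Un_disjoint[symmetric]) (auto intro: arg_cong[of _ _ card])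
    moreover have "real (card {v \<in> W l. \<not> E w v}) \<le> D"
      using insert.prems(4)[OF _ _ ne w] l by simp
    moreover have "real (card (W l)) > real (card J) * D" using insert.prems(3)[of l] cj l by simp
    ultimately show "(real (card J) - 1) * D < real (card (W' l))" by (simp add: algebra_simps)
  next
    fix i l v assume *: "i \<in> J" "l \<in> J" "i \<noteq> l" "v \<in> W' i"
    have "card {x \<in> W' l. \<not> E v x} \<le> card {x \<in> W l. \<not> E v x}"
      using insert.prems(2)[of l] * by (intro card_mono) (auto simp: W'_def)
    moreover have "real (card {x \<in> W l. \<not> E v x}) \<le> D"
      using insert.prems(4)[of i l v] * by (simp add: W'_def)
    ultimately show "real (card {x \<in> W' l. \<not> E v x}) \<le> D" by simp
  qed
  then obtain f where f0: "(\<forall>j\<in>J. f j \<in> W' j) \<and> (\<forall>i\<in>J. \<forall>j\<in>J. i \<noteq> j \<longrightarrow> E (f i) (f j))" ..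
  have f: "\<And>l. l \<in> J \<Longrightarrow> f l \<in> W' l"
    "\<And>i l. i \<in> J \<Longrightarrow> l \<in> J \<Longrightarrow> i \<noteq> l \<Longrightarrow> E (f i) (f l)" using f0 by auto
  have "E w (f l)" if "l \<in> J" for l using f(1)[OF that] by (simp add: W'_def)
  moreover have "f l \<in> W l" if "l \<in> J" for l using f(1)[OF that] by (simp add: W'_def)
  ultimately show ?case
    using f(2) w insert.hyps(2) by (intro exI[of _ "f(j := w)"]) (auto intro: sym)
qed

text \<open>
  Count the edges between the clique and \<open>V\<close>. If \<open>r\<close> members of the clique have at most \<open>k\<close> common
  neighbours, whichever \<open>r\<close> are chosen, then all but \<open>(r + 1) k\<close> vertices have at most \<open>r - 1\<close>
  neighbours in the clique, which contradicts the lower bound on the degrees.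
\<close>

lemma no_large_clique_if_book_free:
  assumes fin: "finite V" and "r \<ge> 1"
    and free: "\<not> contains_book E V r k"
    and deg: "\<And>u. u \<in> V \<Longrightarrow> real (card (nbrs E V u)) \<ge> d"
    and large: "real (r + 1) * d > (real r - 1) * real (card V) + real (r + 1) * real k"
    and K: "K \<subseteq> V" "card K = r + 1"
  shows "\<not> clique E K"
proof
  assume cl: "clique E K"
  have finK: "finite K" using K fin finite_subset by blast
  define C where "C = (\<lambda>w. {v \<in> V. \<forall>u\<in>K - {w}. E u v})"
  have C: "card (C w) \<le> k" if w: "w \<in> K" for w
  proof (rule ccontr)
    assume "\<not> card (C w) \<le> k"
    then obtain C' where C': "C' \<subseteq> C w" "card C' = k"
      by (metis nat_le_linear obtain_subset_with_card_n)
    have "card (K - {w}) = r" using K w finK by simp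
    then have "contains_book E V r k"
      unfolding contains_book_def using K cl C'
      by (intro exI[of _ "K - {w}"] exI[of _ C']) (auto simp: clique_def C_def)
    then show False using free by simp
  qed
  have pointwise: "card {u \<in> K. E u v} \<le> (r - 1) + card {w \<in> K. v \<in> C w}" if v: "v \<in> V" for v
  proof -
    define K' where "K' = {u \<in> K. E u v}"
    have K': "K' \<subseteq> K" "finite K'" using finK by (auto simp: K'_def)
    consider "card K' \<le> r - 1" | "K' = K" | "card K' \<ge> r" "K' \<noteq> K" by linarith
    then show ?thesis
    proof cases
      case 2
      then have "{w \<in> K. v \<in> C w} = K" using v by (auto simp: C_def K'_def)
      then show ?thesis using 2 by (simp add: K'_def)
    next
      case 3
      then have "card K' < r + 1" using K K' finK psubset_card_mono[of K K'] by auto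
      then have r: "card K' = r" using 3 by simp
      obtain w where w: "w \<in> K" "w \<notin> K'" using 3 K' by auto
      have "K' = K - {w}" using w K' finK r K by (intro card_subset_eq) auto
      then have "w \<in> {w \<in> K. v \<in> C w}" using w v by (auto simp: C_def K'_def)
      then have "card {w \<in> K. v \<in> C w} > 0" using finK by (auto simp: card_gt_0_iff)
      then show ?thesis using r by (simp add: K'_def)
    qed (simp add: K'_def)
  qed
  have "real (r + 1) * d \<le> (\<Sum>u\<in>K. real (card (nbrs E V u)))"
    using sum_mono[of K "\<lambda>_. d" "\<lambda>u. real (card (nbrs E V u))"] deg K by (auto simp: subset_iff)
  also have "(\<Sum>u\<in>K. real (card (nbrs E V u))) = real (\<Sum>v\<in>V. card {u \<in> K. E u v})"
    using sum.swap_restrict[OF finK fin, of "\<lambda>_ _. 1 :: nat" E]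
    by (simp add: nbrs_def flip: of_nat_sum)
  also have "\<dots> \<le> real (\<Sum>v\<in>V. (r - 1) + card {w \<in> K. v \<in> C w})"
    unfolding of_nat_le_iff by (rule sum_mono) (rule pointwise)
  also have "\<dots> = (real r - 1) * real (card V) + real (\<Sum>v\<in>V. card {w \<in> K. v \<in> C w})"
    unfolding sum.distrib sum_constant of_nat_add of_nat_mult
    using \<open>r \<ge> 1\<close> by (simp add: of_nat_diff)
  also have "(\<Sum>v\<in>V. card {w \<in> K. v \<in> C w}) = (\<Sum>w\<in>K. card (C w))"
  proof -
    have "{v \<in> V. v \<in> C w} = C w" for w by (auto simp: C_def)
    then show ?thesis using sum.swap_restrict[OF fin finK, of "\<lambda>_ _. 1 :: nat" "\<lambda>v w. v \<in> C w"] by simp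
  qed
  also have "real (\<Sum>w\<in>K. card (C w)) \<le> real (\<Sum>w\<in>K. k)"
    unfolding of_nat_le_iff by (rule sum_mono) (rule C)
  also have "\<dots> = real (r + 1) * real k" using K(2) by (simp add: distrib_right)
  finally show False using large by simp
qed

text \<open>
  Every vertex misses at most \<open>D\<close> vertices, where \<open>D\<close> is close to \<open>m / r\<close>; the small quantity is
  \<open>\<delta> = r D - m\<close>. A greedy clique \<open>f\<close> on \<open>r\<close> vertices defines classes \<open>P i\<close>, the vertices adjacent to
  all members but possibly \<open>f i\<close>. As there is no larger clique, the classes are independent and disjoint. Each
  of them has at least \<open>D - \<delta>\<close> vertices, so a vertex without neighbours in one class misses at most \<open>\<delta>\<close>
  vertices of any other class. Two greedy completions finish the proof: every vertex has no neighbour in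
  some class, which is taken as its colour, and adjacent vertices do not get the same colour.
\<close>

lemma multipartite_if_dense_clique_free:
  fixes D :: real
  assumes fin: "finite V" and r: "r \<ge> 1"
    and nonadj: "\<And>u. u \<in> V \<Longrightarrow> real (card {v \<in> V. \<not> E u v}) \<le> D"
    and D: "real (card V) \<le> real r * D" "2 * real r * (real r * D - real (card V)) < D"
    and no_clique: "\<And>K. K \<subseteq> V \<Longrightarrow> card K = r + 1 \<Longrightarrow> \<not> clique E K"
  shows "\<exists>c. (\<forall>v\<in>V. c v < r) \<and> (\<forall>u\<in>V. \<forall>v\<in>V. E u v \<longrightarrow> c u \<noteq> c v)"
proof -
  define m where "m = real (card V)"
  define \<delta> where "\<delta> = real r * D - m"
  have \<delta>: "\<delta> \<ge> 0" using D by (simp add: \<delta>_def m_def)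
  have D2: "2 * (real r * \<delta>) < D" using D by (simp add: \<delta>_def m_def mult_ac)
  have "real r * \<delta> \<ge> 1 * \<delta>" using r \<delta> by (intro mult_right_mono) auto
  then have D3: "D > 2 * \<delta>" "D \<ge> 0" using D2 \<delta> by auto
  have m_eq: "m - (real r - 1) * D = D - \<delta>" by (simp add: \<delta>_def algebra_simps)
  have split: "card A = card {v \<in> A. E u v} + card {v \<in> A. \<not> E u v}" if "finite A" for u A
    using that by (subst card_Un_disjoint[symmetric]) (auto intro: arg_cong[of _ _ card])
  have nonadj': "real (card {v \<in> A. \<not> E u v}) \<le> D" if "u \<in> V" "A \<subseteq> V" for u A
  proof -
    have "card {v \<in> A. \<not> E u v} \<le> card {v \<in> V. \<not> E u v}" using fin that by (intro card_mono) auto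
    then show ?thesis using nonadj[OF that(1)] by simp
  qed
  \<comment> \<open>an edge \<open>u w\<close> and \<open>r - 1\<close> further vertices, indexed by the \<open>j \<noteq> p\<close>, must not form a clique\<close>
  have extend: False
    if "u \<in> V" "w \<in> V" "E u w" "p < r" and g: "\<And>j. j < r \<Longrightarrow> j \<noteq> p \<Longrightarrow> g j \<in> V \<and> E u (g j) \<and> E w (g j)"
      "\<And>i j. i < r \<Longrightarrow> j < r \<Longrightarrow> i \<noteq> p \<Longrightarrow> j \<noteq> p \<Longrightarrow> i \<noteq> j \<Longrightarrow> E (g i) (g j)" for u w p g
  proof -
    define J where "J = {..<r} - {p}"
    have "inj_on g J" using g(2) irrefl by (force simp: inj_on_def J_def)
    then have "card (g ` J) = r - 1" using \<open>p < r\<close> by (simp add: card_image J_def)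
    moreover have "u \<notin> insert w (g ` J)" "w \<notin> g ` J" "finite (g ` J)"
      using that(3) g(1) irrefl by (auto simp: J_def)
    ultimately have "card (insert u (insert w (g ` J))) = r + 1" using r by simp
    moreover have "insert u (insert w (g ` J)) \<subseteq> V" using that g(1) by (auto simp: J_def)
    moreover have "clique E (insert u (insert w (g ` J)))"
    proof -
      have "E (g i) (g j)" if "i \<in> J" "j \<in> J" "g i \<noteq> g j" for i j
        using that g(2)[of i j] by (auto simp: J_def)
      moreover have "E u (g j)" "E w (g j)" if "j \<in> J" for j using that g(1)[of j] by (auto simp: J_def)
      ultimately show ?thesis using \<open>E u w\<close> unfolding clique_def by (auto intro: sym)
    qed
    ultimately show False using no_clique by blast
  qed
  have "\<exists>f. (\<forall>j\<in>{..<r}. f j \<in> V) \<and> (\<forall>i\<in>{..<r}. \<forall>j\<in>{..<r}. i \<noteq> j \<longrightarrow> E (f i) (f j))"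
    by (rule transversal_clique[where D = D])
      (use D3 fin nonadj m_eq \<delta> in \<open>auto simp: m_def[symmetric]\<close>)
  then obtain f where f: "\<And>j. j < r \<Longrightarrow> f j \<in> V"
    "\<And>i j. i < r \<Longrightarrow> j < r \<Longrightarrow> i \<noteq> j \<Longrightarrow> E (f i) (f j)" by auto
  define P where "P = (\<lambda>i. {v \<in> V. \<forall>j<r. j \<noteq> i \<longrightarrow> E (f j) v})"
  have PV: "P i \<subseteq> V" for i by (auto simp: P_def)
  have PV': "v \<in> V" if "v \<in> P i" for v i using that by (simp add: P_def)
  have finP: "finite (P i)" for i using finite_subset[OF PV fin] .
  have P_adj: "E (f j) v" "E v (f j)" if "v \<in> P i" "j < r" "j \<noteq> i" for i j v
    using that by (auto simp: P_def intro: sym)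
  have P_indep: "\<not> E u w" if "i < r" "u \<in> P i" "w \<in> P i" for i u w
  proof
    assume "E u w"
    then show False
      by (rule extend[of u w i f, rotated 2]) (use that f P_adj PV' in auto)
  qed
  have P_disj: "P i \<inter> P j = {}" if "i < r" "j < r" "i \<noteq> j" for i j
  proof (rule ccontr)
    assume "P i \<inter> P j \<noteq> {}"
    then obtain v where v: "v \<in> P i" "v \<in> P j" by auto
    then have *: "E (f l) v" if "l < r" for l
      using that \<open>i \<noteq> j\<close> P_adj(1)[of v i l] P_adj(1)[of v j l] by (cases "l = i") auto
    have "E v (f l)" if "l < r" for l using *[OF that] by (rule sym)
    then show False
      by (intro extend[of v "f i" i f]) (use that f v PV' in auto)
  qed
  have P_card: "real (card (P i)) \<ge> D - \<delta>" if i: "i < r" for i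
  proof -
    have "V - P i \<subseteq> (\<Union>j\<in>{..<r} - {i}. {v \<in> V. \<not> E (f j) v})" by (auto simp: P_def)
    then have "card (V - P i) \<le> card (\<Union>j\<in>{..<r} - {i}. {v \<in> V. \<not> E (f j) v})"
      using fin by (intro card_mono) auto
    also have "\<dots> \<le> (\<Sum>j\<in>{..<r} - {i}. card {v \<in> V. \<not> E (f j) v})" by (rule card_UN_le) auto
    finally have "real (card (V - P i)) \<le> (\<Sum>j\<in>{..<r} - {i}. real (card {v \<in> V. \<not> E (f j) v}))"
      by (simp flip: of_nat_sum)
    also have "\<dots> \<le> (\<Sum>j\<in>{..<r} - {i}. D)" by (rule sum_mono) (use nonadj f in auto)
    also have "\<dots> = (real r - 1) * D" using i r by (simp add: of_nat_diff)
    also have "real (card (V - P i)) = m - real (card (P i))"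
      using card_Diff_subset[OF finP PV, of i] card_mono[OF fin PV, of i] by (simp add: m_def)
    finally show ?thesis using m_eq by simp
  qed
  have miss: "real (card {v \<in> P j. \<not> E u v}) \<le> \<delta>"
    if "u \<in> V" "i < r" "j < r" "i \<noteq> j" and no: "\<And>v. v \<in> P i \<Longrightarrow> \<not> E u v" for u i j
  proof -
    have "{v \<in> P j. \<not> E u v} \<inter> P i = {}" using P_disj[of i j] that by auto
    then have "card ({v \<in> P j. \<not> E u v} \<union> P i) = card {v \<in> P j. \<not> E u v} + card (P i)"
      using finP by (intro card_Un_disjoint) auto
    moreover have "{v \<in> P j. \<not> E u v} \<union> P i = {v \<in> P j \<union> P i. \<not> E u v}" using no by auto
    ultimately have "real (card {v \<in> P j. \<not> E u v}) + real (card (P i)) \<le> D"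
      using nonadj'[of u "P j \<union> P i"] \<open>u \<in> V\<close> PV by (simp flip: of_nat_add)
    then show ?thesis using P_card[OF \<open>i < r\<close>] by simp
  qed
  \<comment> \<open>\<open>extend\<close> with the further vertices chosen greedily from the classes\<close>
  have no_edge: False
    if uw: "u \<in> V" "w \<in> V" "E u w" "p < r"
      and big: "\<And>j. j < r \<Longrightarrow> j \<noteq> p \<Longrightarrow> real (card {v \<in> P j. E u v \<and> E w v}) > (real r - 2) * \<delta>" for u w p
  proof -
    have "\<exists>g. (\<forall>j\<in>{..<r} - {p}. g j \<in> {v \<in> P j. E u v \<and> E w v}) \<and>
        (\<forall>i\<in>{..<r} - {p}. \<forall>j\<in>{..<r} - {p}. i \<noteq> j \<longrightarrow> E (g i) (g j))"
    proof (rule transversal_clique[OF _ \<delta>])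
      fix j assume "j \<in> {..<r} - {p}"
      then show "(real (card ({..<r} - {p})) - 1) * \<delta> < real (card {v \<in> P j. E u v \<and> E w v})"
        using big[of j] \<open>p < r\<close> by (simp add: of_nat_diff)
    next
      fix i j x assume ij: "i \<in> {..<r} - {p}" "j \<in> {..<r} - {p}" "i \<noteq> j"
        and x: "x \<in> {v \<in> P i. E u v \<and> E w v}"
      have "card {v \<in> {v \<in> P j. E u v \<and> E w v}. \<not> E x v} \<le> card {v \<in> P j. \<not> E x v}"
        using finP by (intro card_mono) auto
      moreover have "real (card {v \<in> P j. \<not> E x v}) \<le> \<delta>"
        using ij x PV P_indep by (intro miss[of x i j]) auto
      ultimately show "real (card {v \<in> {v \<in> P j. E u v \<and> E w v}. \<not> E x v}) \<le> \<delta>" by simp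
    qed (use finP in auto)
    then obtain g where g: "\<And>j. j < r \<Longrightarrow> j \<noteq> p \<Longrightarrow> g j \<in> P j \<and> E u (g j) \<and> E w (g j)"
      "\<And>i j. i < r \<Longrightarrow> j < r \<Longrightarrow> i \<noteq> p \<Longrightarrow> j \<noteq> p \<Longrightarrow> i \<noteq> j \<Longrightarrow> E (g i) (g j)" by auto
    show False by (rule extend[OF uw, of g]) (use g g(1)[THEN conjunct1, THEN PV'] in auto)
  qed
  have rem: "real (card {v \<in> P j. E u v \<and> E w v})
      \<ge> real (card (P j)) - real (card {v \<in> P j. \<not> E u v}) - real (card {v \<in> P j. \<not> E w v})" for j u w
  proof -
    have "card (P j) \<le> card ({v \<in> P j. E u v \<and> E w v} \<union> ({v \<in> P j. \<not> E u v} \<union> {v \<in> P j. \<not> E w v}))"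
      using finP by (intro card_mono) auto
    also have "\<dots> \<le> card {v \<in> P j. E u v \<and> E w v} + (card {v \<in> P j. \<not> E u v} + card {v \<in> P j. \<not> E w v})"
      by (intro order_trans[OF card_Un_le] add_left_mono card_Un_le)
    finally show ?thesis by linarith
  qed
  have colour: "\<exists>i<r. \<forall>v\<in>P i. \<not> E u v" if u: "u \<in> V" for u
  proof (rule ccontr)
    assume "\<not> ?thesis"
    then have ex: "\<And>i. i < r \<Longrightarrow> \<exists>v\<in>P i. E u v" by blast
    \<comment> \<open>Only one class can contain many non-neighbours of \<open>u\<close>. In that class a single neighbour \<open>w\<close> of \<open>u\<close>
      suffices; in every other class at least about half of the vertices are neighbours of \<open>u\<close>.\<close>
    define t where "t = (\<lambda>i. card {v \<in> P i. \<not> E u v})"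
    have "Max (t ` {..<r}) \<in> t ` {..<r}" using r by (intro Max_in) (auto simp: lessThan_empty_iff)
    then obtain p where p0: "p < r" "t p = Max (t ` {..<r})" by auto
    have p: "t j \<le> t p" if "j < r" for j using p0(2) that by auto
    obtain w where w: "w \<in> P p" "E u w" using ex p0(1) by blast
    have "real (card {v \<in> P j. E u v \<and> E w v}) > (real r - 2) * \<delta>" if j: "j < r" "j \<noteq> p" for j
    proof -
      have "{v \<in> P j. \<not> E u v} \<inter> {v \<in> P p. \<not> E u v} = {}" using P_disj[of j p] j p0 by auto
      then have "t j + t p = card ({v \<in> P j. \<not> E u v} \<union> {v \<in> P p. \<not> E u v})"
        unfolding t_def using finP by (intro card_Un_disjoint[symmetric]) auto
      also have "{v \<in> P j. \<not> E u v} \<union> {v \<in> P p. \<not> E u v} = {v \<in> P j \<union> P p. \<not> E u v}" by auto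
      finally have "real (t j) + real (t p) \<le> D"
        using nonadj'[OF u, of "P j \<union> P p"] PV by (simp flip: of_nat_add)
      then have "2 * real (t j) \<le> D" using p[OF j(1)] by linarith
      moreover have "real (card {v \<in> P j. \<not> E w v}) \<le> \<delta>"
        using w PV p0 j P_indep by (intro miss[of w p j]) auto
      ultimately have "2 * real (card {v \<in> P j. E u v \<and> E w v}) \<ge> D - 4 * \<delta>"
        using rem[of j u w] P_card[OF j(1)] by (simp add: t_def)
      moreover have "D - 4 * \<delta> > 2 * ((real r - 2) * \<delta>)" using D2 by (simp add: algebra_simps)
      ultimately show ?thesis by linarith
    qed
    then show False by (rule no_edge[OF u PV'[OF w(1)] w(2) p0(1)])
  qed
  define c where "c = (\<lambda>u. SOME i. i < r \<and> (\<forall>v\<in>P i. \<not> E u v))"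
  have c: "c u < r" "\<And>v. v \<in> P (c u) \<Longrightarrow> \<not> E u v" if "u \<in> V" for u
    using someI_ex[OF colour[OF that]] by (auto simp: c_def)
  have "c u \<noteq> c w" if uw: "u \<in> V" "w \<in> V" "E u w" for u w
  proof
    assume eq: "c u = c w"
    have "real (card {v \<in> P j. E u v \<and> E w v}) > (real r - 2) * \<delta>" if j: "j < r" "j \<noteq> c u" for j
    proof -
      have "real (card {v \<in> P j. \<not> E u v}) \<le> \<delta>" "real (card {v \<in> P j. \<not> E w v}) \<le> \<delta>"
        using miss[of u "c u" j] miss[of w "c w" j] c[of u] c[of w] uw j eq by auto
      then have "real (card {v \<in> P j. E u v \<and> E w v}) \<ge> D - 3 * \<delta>"
        using rem[of j u w] P_card[OF j(1)] by simp
      moreover have "D - 3 * \<delta> > (real r - 2) * \<delta>"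
        using D2 \<delta> \<open>real r * \<delta> \<ge> 1 * \<delta>\<close> by (simp add: algebra_simps)
      ultimately show ?thesis by linarith
    qed
    then show False by (rule no_edge[OF uw c(1)[OF uw(1)]])
  qed
  then show ?thesis using c(1) by blast
qed

text \<open>
  The constant \<open>1 / (4 r\<^sup>3)\<close> makes \<open>2 r (r D - m) = m / (2 r)\<close> for \<open>D = (1 / r + 1 / (4 r\<^sup>3)) m\<close>, which is
  safely below \<open>D\<close>.
\<close>

lemma dense_book_free_multipartite:
  assumes fin: "finite V" and r: "r \<ge> 3"
    and free: "\<not> contains_book E V r k"
    and large: "card V > 2 * (r + 1) * k"
    and deg: "\<And>u. u \<in> V \<Longrightarrow>
      real (card (nbrs E V u)) \<ge> (1 - 1 / real r - 1 / (4 * real r ^ 3)) * real (card V)"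
  shows "\<exists>c. (\<forall>v\<in>V. c v < r) \<and> (\<forall>u\<in>V. \<forall>v\<in>V. E u v \<longrightarrow> c u \<noteq> c v)"
proof -
  define m where "m = real (card V)"
  define \<epsilon> where "\<epsilon> = 1 / (4 * real r ^ 3)"
  define d where "d = (1 - 1 / real r - \<epsilon>) * m"
  define D where "D = (1 / real r + \<epsilon>) * m"
  have m: "m > 0" using large by (simp add: m_def)
  have rD: "real r * D = m + real r * \<epsilon> * m" using r by (simp add: D_def field_simps)
  have \<epsilon>: "\<epsilon> > 0" "2 * real r * (real r * \<epsilon>) = 1 / (2 * real r)"
    using r by (auto simp: \<epsilon>_def field_simps power3_eq_cube)
  have no_clique: "\<not> clique E K" if "K \<subseteq> V" "card K = r + 1" for K
  proof (rule no_large_clique_if_book_free[OF fin _ free _ _ that])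
    show "r \<ge> 1" using r by simp
    show "d \<le> real (card (nbrs E V u))" if "u \<in> V" for u
      using deg[OF that] by (simp add: d_def \<epsilon>_def m_def)
    have "real (r + 1) * \<epsilon> \<le> 1 / 6"
    proof -
      have "real (r + 1) * \<epsilon> \<le> (2 * real r * real r) * \<epsilon>"
        using r \<epsilon> mult_mono[of 1 "real r" 1 "real r"] by (intro mult_right_mono) (auto simp: mult.assoc intro: order_trans[of _ "2 * real r"])
      also have "\<dots> = 1 / (2 * real r)" using \<epsilon>(2) by (simp add: mult_ac)
      also have "\<dots> \<le> 1 / 6" using r by (simp add: field_simps)
      finally show ?thesis .
    qed
    moreover have "1 / real r \<le> 1 / 3" using r by (simp add: field_simps)
    moreover have "real (r + 1) * (1 - 1 / real r - \<epsilon>) = real r - 1 / real r - real (r + 1) * \<epsilon>"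
      using r by (simp add: field_simps)
    ultimately have "real (r + 1) * (1 - 1 / real r - \<epsilon>) \<ge> real r - 1 + 1 / 2" by linarith
    then have "real (r + 1) * (1 - 1 / real r - \<epsilon>) * m \<ge> (real r - 1 + 1 / 2) * m"
      using m by (intro mult_right_mono) auto
    then have "real (r + 1) * d \<ge> (real r - 1) * m + m / 2" by (simp add: d_def algebra_simps)
    moreover have "m > 2 * (real (r + 1) * real k)"
      using large unfolding m_def of_nat_less_iff[symmetric, where 'a = real] by (simp add: algebra_simps)
    ultimately show "(real r - 1) * real (card V) + real (r + 1) * real k < real (r + 1) * d"
      by (simp add: m_def)
  qed
  show ?thesis
  proof (rule multipartite_if_dense_clique_free[OF fin _ _ _ _ no_clique])
    show "r \<ge> 1" using r by simp
    show "real (card {v \<in> V. \<not> E u v}) \<le> D" if u: "u \<in> V" for u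
    proof -
      have sub: "nbrs E V u \<subseteq> V" by (auto simp: nbrs_def)
      have "{v \<in> V. \<not> E u v} = V - nbrs E V u" by (auto simp: nbrs_def)
      then have "real (card {v \<in> V. \<not> E u v}) = m - real (card (nbrs E V u))"
        using card_Diff_subset[OF _ sub] card_mono[OF fin sub] fin by (simp add: m_def)
      then show ?thesis using deg[OF u] by (simp add: D_def \<epsilon>_def m_def algebra_simps)
    qed
    show "real (card V) \<le> real r * D" unfolding rD using \<epsilon> m by (simp add: m_def)
    have "2 * real r * (real r * D - m) = (2 * real r * (real r * \<epsilon>)) * m" unfolding rD by simp
    also have "\<dots> = 1 / (2 * real r) * m" unfolding \<epsilon>(2) ..
    also have "\<dots> < D"
    proof -
      have "1 / (2 * real r) \<le> 1 / real r" using r by (simp add: field_simps)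
      then show ?thesis unfolding D_def using \<epsilon>(1) m by (intro mult_strict_right_mono) auto
    qed
    finally show "2 * real r * (real r * D - real (card V)) < D" by (simp add: m_def)
  qed
qed

end

section \<open>The eigenvalue equation of a multipartite graph\<close>

text \<open>
  In a complete multipartite graph with eigenvalue \<open>q = p + n\<close>, a class of \<open>t\<close> vertices carries the
  fraction \<open>t / (p + 2 t)\<close> of the sum of all entries of the eigenvector; below it is called a share. The
  share is concave in \<open>t\<close>. The identity measures how far the line through two consecutive integers \<open>s\<close>
  and \<open>s + 1\<close> lies above it: the factor \<open>(t - s) (t - s - 1)\<close> is nonnegative at all integers and vanishes
  only at the two ends.
\<close>

lemma share_chord:
  fixes p s t :: real
  assumes "p > 0" "s \<ge> 0" "t \<ge> 0"
  shows "s / (p + 2 * s) + (t - s) * ((s + 1) / (p + 2 * (s + 1)) - s / (p + 2 * s)) - t / (p + 2 * t)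
    = 2 * p * ((t - s) * (t - s - 1)) / ((p + 2 * s) * (p + 2 * (s + 1)) * (p + 2 * t))"
proof -
  have "p + 2 * s \<noteq> 0" "p + 2 * (s + 1) \<noteq> 0" "p + 2 * t \<noteq> 0" using assms by auto
  then show ?thesis by (simp add: divide_simps) (simp add: algebra_simps)
qed

lemma share_le_chord:
  fixes p :: real and s t :: nat
  assumes "p > 0"
  defines "\<phi> \<equiv> \<lambda>t :: nat. real t / (p + 2 * real t)"
  shows "\<phi> t \<le> \<phi> s + (real t - real s) * (\<phi> (s + 1) - \<phi> s)"
    and "\<phi> t = \<phi> s + (real t - real s) * (\<phi> (s + 1) - \<phi> s) \<longleftrightarrow> t = s \<or> t = s + 1"
proof -
  have eq: "\<phi> s + (real t - real s) * (\<phi> (s + 1) - \<phi> s) - \<phi> t = 2 * p * ((real t - real s) * (real t - real s - 1))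
      / ((p + 2 * real s) * (p + 2 * (real s + 1)) * (p + 2 * real t))"
    using share_chord[OF assms(1), of "real s" "real t"] by (simp add: \<phi>_def add.commute)
  have den: "(p + 2 * real s) * (p + 2 * (real s + 1)) * (p + 2 * real t) > 0"
    using assms(1) by (intro mult_pos_pos) auto
  have "(real t - real s) * (real t - real s - 1) \<ge> 0"
  proof (cases "t \<le> s")
    case True
    then show ?thesis by (intro mult_nonpos_nonpos) auto
  next
    case False
    then have "real t \<ge> real s + 1" by linarith
    then show ?thesis by (intro mult_nonneg_nonneg) auto
  qed
  then have "2 * p * ((real t - real s) * (real t - real s - 1))
      / ((p + 2 * real s) * (p + 2 * (real s + 1)) * (p + 2 * real t)) \<ge> 0"
    using assms(1) by (intro divide_nonneg_pos[OF _ den] mult_nonneg_nonneg[of "2 * p"]) auto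
  then show "\<phi> t \<le> \<phi> s + (real t - real s) * (\<phi> (s + 1) - \<phi> s)" using eq by linarith
  have "\<phi> t = \<phi> s + (real t - real s) * (\<phi> (s + 1) - \<phi> s) \<longleftrightarrow>
      2 * p * ((real t - real s) * (real t - real s - 1))
      / ((p + 2 * real s) * (p + 2 * (real s + 1)) * (p + 2 * real t)) = 0"
    using eq by linarith
  also have "\<dots> \<longleftrightarrow> (real t - real s) * (real t - real s - 1) = 0" using den assms(1) by simp
  also have "\<dots> \<longleftrightarrow> t = s \<or> t = s + 1"
  proof -
    have "real t - real s = 0 \<longleftrightarrow> t = s" "real t - real s - 1 = 0 \<longleftrightarrow> t = s + 1" by linarith+
    then show ?thesis by (simp only: mult_eq_0_iff)
  qed
  finally show "\<phi> t = \<phi> s + (real t - real s) * (\<phi> (s + 1) - \<phi> s) \<longleftrightarrow> t = s \<or> t = s + 1" .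
qed

text \<open>
  The chord is affine, so its sum depends only on the total size; it agrees with the sum of the shares
  exactly if all classes have size \<open>s\<close> or \<open>s + 1\<close>.
\<close>

lemma sum_share_balanced:
  fixes p :: real and n t :: "nat \<Rightarrow> nat"
  assumes p: "p > 0" and sums: "(\<Sum>i<r. n i) = (\<Sum>i<r. t i)"
    and t: "\<And>i. i < r \<Longrightarrow> t i = s \<or> t i = s + 1"
  shows "(\<Sum>i<r. real (n i) / (p + 2 * real (n i))) \<le> (\<Sum>i<r. real (t i) / (p + 2 * real (t i)))"
    and "(\<Sum>i<r. real (n i) / (p + 2 * real (n i))) = (\<Sum>i<r. real (t i) / (p + 2 * real (t i)))
      \<Longrightarrow> i < r \<Longrightarrow> n i = s \<or> n i = s + 1"
proof -
  define \<phi> where "\<phi> = (\<lambda>t :: nat. real t / (p + 2 * real t))"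
  define L where "L = (\<lambda>t :: nat. \<phi> s + (real t - real s) * (\<phi> (s + 1) - \<phi> s))"
  have chord: "\<phi> t \<le> L t" "\<phi> t = L t \<longleftrightarrow> t = s \<or> t = s + 1" for t
    using share_le_chord[OF p, of t s] by (simp_all add: \<phi>_def L_def)
  have L: "(\<Sum>i<r. L (n i)) = (\<Sum>i<r. L (t i))"
  proof -
    have "real (\<Sum>i<r. n i) = real (\<Sum>i<r. t i)" using sums by simp
    then show ?thesis
      by (simp add: L_def sum.distrib sum_subtractf flip: sum_distrib_right)
  qed
  also have "\<dots> = (\<Sum>i<r. \<phi> (t i))"
  proof (intro sum.cong refl)
    fix i assume "i \<in> {..<r}"
    then have "\<phi> (t i) = L (t i)" unfolding chord(2) using t by simp
    then show "L (t i) = \<phi> (t i)" by simp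
  qed
  finally have L: "(\<Sum>i<r. L (n i)) = (\<Sum>i<r. \<phi> (t i))" .
  have le: "(\<Sum>i<r. \<phi> (n i)) \<le> (\<Sum>i<r. L (n i))" by (rule sum_mono) (rule chord)
  then show "(\<Sum>i<r. real (n i) / (p + 2 * real (n i))) \<le> (\<Sum>i<r. real (t i) / (p + 2 * real (t i)))"
    unfolding L by (simp add: \<phi>_def)
  assume "(\<Sum>i<r. real (n i) / (p + 2 * real (n i))) = (\<Sum>i<r. real (t i) / (p + 2 * real (t i)))"
  then have "(\<Sum>i<r. L (n i) - \<phi> (n i)) = 0" by (simp add: sum_subtractf L) (simp add: \<phi>_def)
  then have "\<forall>i\<in>{..<r}. L (n i) - \<phi> (n i) = 0"
    using chord(1) by (subst (asm) sum_nonneg_eq_0_iff) auto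
  moreover assume "i < r"
  ultimately show "n i = s \<or> n i = s + 1" using chord(2)[of "n i"] by auto
qed

context adjacency
begin

text \<open>
  Let \<open>S\<close> be the sum of the eigenvector entries and \<open>T i\<close> the part of it in class \<open>i\<close>. At a vertex \<open>u\<close> of
  class \<open>i\<close> the eigenvalue equation reads \<open>(p + n i) x u = S - T i - s u\<close>, where \<open>s u \<ge> 0\<close> collects the
  edges missing between \<open>u\<close> and the other classes. Summation over the class and then over all classes gives
  \<open>S = S \<Sum>\<^sub>i n i / (p + 2 n i)\<close> minus a nonnegative combination of the \<open>s u\<close>. If that combination
  vanishes, all entries of \<open>x\<close> are positive, so that no edge can be missing.
\<close>

lemma multipartite_shares:
  assumes fin: "finite V" and ne: "V \<noteq> {}"
    and range: "\<And>v. v \<in> V \<Longrightarrow> c v < r"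
    and proper: "\<And>u v. u \<in> V \<Longrightarrow> v \<in> V \<Longrightarrow> E u v \<Longrightarrow> c u \<noteq> c v"
    and q: "qmax E V > real (card V)"
  defines "p \<equiv> qmax E V - real (card V)"
    and "n \<equiv> \<lambda>i :: nat. real (card {v \<in> V. c v = i})"
  shows "1 \<le> (\<Sum>i<r. n i / (p + 2 * n i))"
    and "(\<Sum>i<r. n i / (p + 2 * n i)) = 1 \<longleftrightarrow> (\<forall>u\<in>V. \<forall>v\<in>V. c u \<noteq> c v \<longrightarrow> E u v)"
proof -
  obtain x where x: "\<And>v. x v \<ge> 0" "(\<Sum>v\<in>V. (x v)\<^sup>2) = 1"
    "\<And>u. u \<in> V \<Longrightarrow> qapply E V x u = qmax E V * x u" "qform E V x = qmax E V"
    by (rule qmax_eigenvector[OF fin ne]) (rule that)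
  define m where "m = real (card V)"
  define S where "S = (\<Sum>v\<in>V. x v)"
  define P where "P = (\<lambda>i. {v \<in> V. c v = i})"
  define T where "T = (\<lambda>i. \<Sum>v\<in>P i. x v)"
  have p: "p > 0" using q by (simp add: p_def)
  have finP: "finite (P i)" for i using fin by (simp add: P_def)
  have n_card: "n i = real (card (P i))" for i by (simp add: n_def P_def)
  have n0: "n i \<ge> 0" for i by (simp add: n_def)
  have "S > 0"
  proof -
    obtain v where "v \<in> V" "x v \<noteq> 0" using x(2) by (metis (no_types, lifting) sum.neutral zero_neq_one zero_power2)
    then show ?thesis unfolding S_def using fin x(1) by (intro sum_pos2[of _ v]) (auto simp: less_le)
  qed
  have cover: "(\<Sum>i<r. \<Sum>v\<in>P i. f v) = (\<Sum>v\<in>V. f v)" for f :: "'a \<Rightarrow> real"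
    unfolding P_def by (rule sum.group) (use fin range in auto)
  define s where "s = (\<lambda>u. (\<Sum>v\<in>V - P (c u) - nbrs E V u. x u + x v))"
  have s0: "s u \<ge> 0" for u unfolding s_def by (intro sum_nonneg add_nonneg_nonneg x)
  have vertex: "(p + n (c u)) * x u = S - T (c u) - s u" if u: "u \<in> V" for u
  proof -
    have sub: "nbrs E V u \<subseteq> V - P (c u)" 
    proof
      fix v assume "v \<in> nbrs E V u"
      then have "v \<in> V" "c u \<noteq> c v" using proper[OF u, of v] by (auto simp: nbrs_def)
      then show "v \<in> V - P (c u)" by (simp add: P_def)
    qed
    have PV: "P (c u) \<subseteq> V" by (auto simp: P_def)
    have "qapply E V x u + s u = (\<Sum>v\<in>V - P (c u). x u + x v)"
      unfolding qapply_def s_def using sum.subset_diff[OF sub, of "\<lambda>v. x u + x v"] fin by simp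
    also have "\<dots> = (m - n (c u)) * x u + (S - T (c u))"
      using card_Diff_subset[OF finP PV] card_mono[OF fin PV] sum_diff[OF fin PV, of x]
      by (simp add: sum.distrib m_def n_card S_def T_def)
    finally show ?thesis using x(3)[OF u] by (simp add: p_def m_def algebra_simps)
  qed
  define \<sigma> where "\<sigma> = (\<lambda>i. \<Sum>u\<in>P i. s u)"
  have part: "(p + 2 * n i) * T i = n i * S - \<sigma> i" for i
  proof -
    have "(p + n i) * T i = (\<Sum>u\<in>P i. (p + n i) * x u)" by (simp add: T_def sum_distrib_left)
    also have "\<dots> = (\<Sum>u\<in>P i. S - T i - s u)" by (intro sum.cong) (use vertex in \<open>auto simp: P_def\<close>)
    also have "\<dots> = n i * (S - T i) - \<sigma> i"
      by (simp add: sum_subtractf \<sigma>_def n_card algebra_simps)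
    finally show ?thesis by (simp add: algebra_simps)
  qed
  have pos: "p + 2 * n i > 0" for i using p n0[of i] by simp
  have T: "T i = S * (n i / (p + 2 * n i)) - \<sigma> i / (p + 2 * n i)" for i
  proof -
    have "T i = (n i * S - \<sigma> i) / (p + 2 * n i)"
      using part[of i] pos[of i] by (simp only: eq_divide_eq mult.commute) simp
    then show ?thesis by (simp add: diff_divide_distrib mult.commute)
  qed
  have \<sigma>0: "\<sigma> i \<ge> 0" for i unfolding \<sigma>_def by (intro sum_nonneg s0)
  have total: "S = S * (\<Sum>i<r. n i / (p + 2 * n i)) - (\<Sum>i<r. \<sigma> i / (p + 2 * n i))"
  proof -
    have "S = (\<Sum>i<r. T i)" using cover[of x] by (simp add: S_def T_def)
    also have "\<dots> = S * (\<Sum>i<r. n i / (p + 2 * n i)) - (\<Sum>i<r. \<sigma> i / (p + 2 * n i))"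
      unfolding T by (simp add: sum_subtractf sum_distrib_left)
    finally show ?thesis .
  qed
  have slack0: "(\<Sum>i<r. \<sigma> i / (p + 2 * n i)) \<ge> 0" using \<sigma>0 pos by (intro sum_nonneg divide_nonneg_pos)
  then have "S * 1 \<le> S * (\<Sum>i<r. n i / (p + 2 * n i))" using total by simp
  then show "1 \<le> (\<Sum>i<r. n i / (p + 2 * n i))" using \<open>S > 0\<close> by simp
  have "(\<Sum>i<r. n i / (p + 2 * n i)) = 1 \<longleftrightarrow> S * (\<Sum>i<r. n i / (p + 2 * n i)) = S" using \<open>S > 0\<close> by simp
  also have "\<dots> \<longleftrightarrow> (\<Sum>i<r. \<sigma> i / (p + 2 * n i)) = 0" using total by linarith
  also have "\<dots> \<longleftrightarrow> (\<forall>i<r. \<sigma> i = 0)"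
    using \<sigma>0 pos by (subst sum_nonneg_eq_0_iff) (auto intro!: divide_nonneg_pos simp: less_imp_neq[OF pos, symmetric])
  also have "\<dots> \<longleftrightarrow> (\<forall>u\<in>V. s u = 0)"
  proof -
    have "\<sigma> i = 0 \<longleftrightarrow> (\<forall>u\<in>P i. s u = 0)" for i
      by (simp add: \<sigma>_def sum_nonneg_eq_0_iff s0 finP)
    then show ?thesis using range unfolding P_def by simp blast
  qed
  also have "\<dots> \<longleftrightarrow> (\<forall>u\<in>V. \<forall>v\<in>V. c u \<noteq> c v \<longrightarrow> E u v)"
  proof (intro ball_cong refl iffI)
    fix u assume u: "u \<in> V" and "\<forall>v\<in>V. c u \<noteq> c v \<longrightarrow> E u v"
    then have "V - P (c u) - nbrs E V u = {}" by (auto simp: P_def nbrs_def)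
    then show "s u = 0" by (simp only: s_def sum.empty)
  next
    fix u assume u: "u \<in> V" and su: "s u = 0"
    have "(p + 2 * n (c u)) * T (c u) < (p + 2 * n (c u)) * S"
    proof -
      have "(p + 2 * n (c u)) * T (c u) \<le> n (c u) * S" using part[of "c u"] \<sigma>0[of "c u"] by simp
      also have "\<dots> < (p + 2 * n (c u)) * S" using p n0[of "c u"] \<open>S > 0\<close> by (intro mult_strict_right_mono) auto
      finally show ?thesis .
    qed
    then have "T (c u) < S" using pos by simp
    then have "(p + n (c u)) * x u > 0" using vertex[OF u] su by simp
    then have xu: "x u > 0" using x(1)[of u] by (simp add: zero_less_mult_iff less_le)
    show "\<forall>v\<in>V. c u \<noteq> c v \<longrightarrow> E u v"
    proof (intro ballI impI, rule ccontr)
      fix v assume v: "v \<in> V" "c u \<noteq> c v" "\<not> E u v"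
      have "s u > 0" unfolding s_def
        by (rule sum_pos2[of _ v]) (use v fin xu x(1) in \<open>auto simp: P_def nbrs_def add_pos_nonneg\<close>)
      then show False using su by simp
    qed
  qed
  finally show "(\<Sum>i<r. n i / (p + 2 * n i)) = 1 \<longleftrightarrow> (\<forall>u\<in>V. \<forall>v\<in>V. c u \<noteq> c v \<longrightarrow> E u v)" .
qed

lemma sum_part_sizes:
  fixes c :: "'a \<Rightarrow> nat"
  assumes "finite V" "\<And>v. v \<in> V \<Longrightarrow> c v < r"
  shows "(\<Sum>i<r. card {v \<in> V. c v = i}) = card V"
  using sum.group[of V "{..<r}" c "\<lambda>_. 1 :: nat"] assms by (auto simp: image_subset_iff)

text \<open>
  Concavity again: the share is replaced by its tangent at the average class size \<open>\<mu> = n / r\<close>.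
\<close>

lemma multipartite_qmax_le:
  assumes fin: "finite V" and ne: "V \<noteq> {}" and r: "r \<ge> 2"
    and range: "\<And>v. v \<in> V \<Longrightarrow> c v < r"
    and proper: "\<And>u v. u \<in> V \<Longrightarrow> v \<in> V \<Longrightarrow> E u v \<Longrightarrow> c u \<noteq> c v"
  shows "qmax E V \<le> 2 * (1 - 1 / real r) * real (card V)"
proof (cases "qmax E V > real (card V)")
  case False
  have "1 * real (card V) \<le> 2 * (1 - 1 / real r) * real (card V)"
    using r by (intro mult_right_mono) (auto simp: field_simps)
  then show ?thesis using False by simp
next
  case True
  define m where "m = real (card V)"
  define p where "p = qmax E V - m"
  define \<mu> where "\<mu> = m / real r"
  define n where "n = (\<lambda>i :: nat. real (card {v \<in> V. c v = i}))"
  have p: "p > 0" using True by (simp add: p_def m_def)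
  have m: "m > 0" using fin ne by (simp add: m_def card_gt_0_iff)
  then have \<mu>: "\<mu> > 0" "real r * \<mu> = m" using r by (auto simp: \<mu>_def)
  have "real (\<Sum>i<r. card {v \<in> V. c v = i}) = m" using sum_part_sizes[OF fin range] by (simp add: m_def)
  then have sum_n: "(\<Sum>i<r. n i) = m" by (simp add: n_def)
  have tangent: "t / (p + 2 * t) \<le> \<mu> / (p + 2 * \<mu>) + p / (p + 2 * \<mu>)\<^sup>2 * (t - \<mu>)" if "t \<ge> 0" for t
  proof -
    have "p + 2 * t > 0" "p + 2 * \<mu> > 0" using p \<mu> that by auto
    then have "\<mu> / (p + 2 * \<mu>) + p / (p + 2 * \<mu>)\<^sup>2 * (t - \<mu>) - t / (p + 2 * t)
        = 2 * p * (t - \<mu>)\<^sup>2 / ((p + 2 * \<mu>)\<^sup>2 * (p + 2 * t))"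
      by (simp add: divide_simps power2_eq_square) (simp add: algebra_simps)
    also have "\<dots> \<ge> 0" using p \<open>p + 2 * t > 0\<close> by simp
    finally show ?thesis by simp
  qed
  have "1 \<le> (\<Sum>i<r. n i / (p + 2 * n i))"
    using multipartite_shares(1)[OF fin ne range proper True] by (simp add: p_def m_def n_def)
  also have "\<dots> \<le> (\<Sum>i<r. \<mu> / (p + 2 * \<mu>) + p / (p + 2 * \<mu>)\<^sup>2 * (n i - \<mu>))"
    by (rule sum_mono) (rule tangent, simp add: n_def)
  also have "\<dots> = real r * \<mu> / (p + 2 * \<mu>) + p / (p + 2 * \<mu>)\<^sup>2 * ((\<Sum>i<r. n i) - real r * \<mu>)"
    unfolding sum.distrib sum_distrib_left[symmetric] sum_subtractf by simp
  also have "\<dots> = m / (p + 2 * \<mu>)" using \<mu> sum_n by simp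
  finally have "p + 2 * \<mu> \<le> m" using p \<mu> by (simp add: field_simps)
  then show ?thesis by (simp add: p_def \<mu>_def m_def algebra_simps)
qed

lemma qmax_ge_average_degree:
  assumes "finite V"
  shows "2 * (\<Sum>u\<in>V. real (card (nbrs E V u))) \<le> qmax E V * real (card V)"
  using qform_le_qmax[OF assms, of "\<lambda>_. 1"]
  by (simp add: qform_def qapply_def sum_distrib_left mult.commute)

end

section \<open>Book-free graphs of large spectral radius\<close>

lemma harmonic_tail_exceeds: "\<exists>N. \<forall>n\<ge>N. (\<Sum>j\<in>{M<..n}. 1 / real j) > B"
proof -
  have "\<exists>N. (\<Sum>j\<in>{M<..N}. 1 / real j) > B"
  proof (rule ccontr)
    assume "\<not> ?thesis"
    then have le: "(\<Sum>j\<in>{M<..N}. 1 / real j) \<le> B" for N by (meson not_le)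
    have "summable (\<lambda>j. 1 / real j)"
    proof (rule summableI_nonneg_bounded)
      fix n
      have "(\<Sum>j<n. 1 / real j) \<le> (\<Sum>j\<in>{..M} \<union> {M<..n}. 1 / real j)"
        by (rule sum_mono2) auto
      also have "\<dots> = (\<Sum>j\<le>M. 1 / real j) + (\<Sum>j\<in>{M<..n}. 1 / real j)"
        by (rule sum.union_disjoint) auto
      finally show "(\<Sum>j<n. 1 / real j) \<le> (\<Sum>j\<le>M. 1 / real j) + B" using le[of n] by linarith
    qed auto
    then show False using not_summable_harmonic[where 'a = real] by (simp add: inverse_eq_divide)
  qed
  then obtain N where N: "(\<Sum>j\<in>{M<..N}. 1 / real j) > B" by blast
  have "(\<Sum>j\<in>{M<..n}. 1 / real j) > B" if "n \<ge> N" for n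
  proof -
    have "(\<Sum>j\<in>{M<..N}. 1 / real j) \<le> (\<Sum>j\<in>{M<..n}. 1 / real j)"
      by (rule sum_mono2) (use that in auto)
    then show ?thesis using N by simp
  qed
  then show ?thesis by blast
qed

context adjacency
begin

text \<open>
  As long as \<open>q\<close> exceeds \<open>2 a n\<close>, a vertex of low degree exists and a deletion raises \<open>q / n\<close> by at least
  \<open>\<epsilon> / (12 n)\<close>. Deletions down to \<open>M\<close> vertices add these increments to the initial value, and \<open>q / n\<close>
  never exceeds \<open>2\<close>.
\<close>

lemma qmax_excess_bound:
  assumes \<epsilon>: "0 < \<epsilon>" "\<epsilon> \<le> 1/6" and a: "2/3 \<le> a" "a \<le> 1"
    and M: "real M \<ge> 24 / \<epsilon>"
    and low: "\<And>W. finite W \<Longrightarrow> card W > M \<Longrightarrow> \<not> contains_book E W r k \<Longrightarrow>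
      qmax E W > 2 * a * real (card W) \<Longrightarrow> \<exists>w\<in>W. real (card (nbrs E W w)) \<le> (a - \<epsilon>) * real (card W)"
    and "M \<le> n" "finite V" "card V = n" "\<not> contains_book E V r k" "qmax E V > 2 * a * real n"
  shows "qmax E V / real n + \<epsilon> / 12 * (\<Sum>j\<in>{M<..n}. 1 / real j) \<le> 2"
  using assms(7-)
proof (induction n arbitrary: V rule: dec_induct)
  case base
  have "M > 0" using M \<epsilon> by (metis divide_pos_pos not_le of_nat_0_less_iff order_less_le_trans zero_less_numeral)
  then have "V \<noteq> {}" using base by auto
  then show ?case using qmax_le_twice_card[OF base(1)] base(2) \<open>M > 0\<close> by (simp add: divide_le_eq)
next
  case (step n)
  have "24 / \<epsilon> > 0" using \<epsilon> by simp
  then have n: "real n > 0" "real n \<ge> 24 / \<epsilon>" using M step.hyps by linarith+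
  have cV: "real (card V) = real n + 1" using step.prems by simp
  obtain w where w: "w \<in> V" "real (card (nbrs E V w)) \<le> (a - \<epsilon>) * real (card V)"
    using low[of V] step.prems step.hyps by auto
  have q: "(2 * a - \<epsilon>) * real (card V) \<le> qmax E V"
  proof -
    have "(2 * a - \<epsilon>) * real (card V) \<le> 2 * a * real (card V)" using \<epsilon> by (intro mult_right_mono) auto
    also have "\<dots> \<le> qmax E V" using step.prems(2,4) by simp
    finally show ?thesis .
  qed
  have "24 / \<epsilon> \<le> real (card V)" using n cV by simp
  from qmax_density_increment[OF step.prems(1) w(1) \<epsilon> a q w(2) this]
  obtain u where u: "u \<in> V" and inc: "qmax E (V - {u})
      \<ge> (qmax E V / (real n + 1) + \<epsilon> / (12 * (real n + 1))) * real n"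
    unfolding cV by auto
  define W where "W = V - {u}"
  have W: "finite W" "card W = n" "\<not> contains_book E W r k"
    using step.prems u contains_book_mono[of E W r k V] by (auto simp: W_def)
  have qW: "qmax E V / (real n + 1) + \<epsilon> / (12 * (real n + 1)) \<le> qmax E W / real n"
    using inc n by (simp add: W_def pos_le_divide_eq)
  have "qmax E V / (real n + 1) > 2 * a" using step.prems(4) n by (simp add: pos_less_divide_eq add.commute)
  moreover have "\<epsilon> / (12 * (real n + 1)) > 0" using \<epsilon> n by simp
  ultimately have "qmax E W / real n > 2 * a" using qW by linarith
  then have "qmax E W > 2 * a * real n" using n by (simp add: pos_less_divide_eq)
  from step.IH[OF W this]
  have "qmax E W / real n + \<epsilon> / 12 * (\<Sum>j\<in>{M<..n}. 1 / real j) \<le> 2" .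
  moreover have "{M<..Suc n} = insert (Suc n) {M<..n}" using step.hyps by auto
  then have "\<epsilon> / 12 * (\<Sum>j\<in>{M<..Suc n}. 1 / real j)
      = \<epsilon> / 12 * (\<Sum>j\<in>{M<..n}. 1 / real j) + \<epsilon> / (12 * (real n + 1))"
    by (simp add: distrib_left add.commute)
  ultimately have "qmax E V / (real n + 1) + \<epsilon> / 12 * (\<Sum>j\<in>{M<..Suc n}. 1 / real j) \<le> 2"
    using qW by linarith
  then show ?case by (simp add: add.commute)
qed

end

text \<open>
  The term \<open>2 r / n\<close> leaves room for the Turan graph, whose \<open>q\<close> may lie slightly below
  \<open>2 (1 - 1/r) n\<close> when \<open>r\<close> does not divide \<open>n\<close>. A single deletion gains more than that and leads to
  a graph with \<open>q > 2 (1 - 1/r) (n - 1)\<close>, which \<open>qmax_excess_bound\<close> excludes.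
\<close>

lemma near_extremal_multipartite:
  fixes r k :: nat
  assumes r: "r \<ge> 3"
  shows "\<exists>N. \<forall>(E :: 'a \<Rightarrow> 'a \<Rightarrow> bool) V. adjacency E \<and> finite V \<and> card V \<ge> N \<and> \<not> contains_book E V r k \<and>
    qmax E V \<ge> 2 * (1 - 1 / real r) * real (card V) - 2 * real r / real (card V) \<longrightarrow>
    (\<exists>c. (\<forall>v\<in>V. c v < r) \<and> (\<forall>u\<in>V. \<forall>v\<in>V. E u v \<longrightarrow> c u \<noteq> c v))"
proof -
  define \<epsilon> where "\<epsilon> = 1 / (4 * real r ^ 3)"
  define a where "a = 1 - 1 / real r"
  have "real r ^ 3 \<ge> 3 ^ 3" using r by (intro power_mono) auto
  then have \<epsilon>: "0 < \<epsilon>" "\<epsilon> \<le> 1 / 6" using r by (auto simp: \<epsilon>_def field_simps)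
  have a: "2 / 3 \<le> a" "a \<le> 1" using r by (auto simp: a_def field_simps)
  define M where "M = nat \<lceil>24 / \<epsilon>\<rceil> + nat \<lceil>24 * real r / \<epsilon>\<rceil> + 2 * (r + 1) * k"
  have M: "real M \<ge> 24 / \<epsilon>" "real M \<ge> 24 * real r / \<epsilon>" "M \<ge> 2 * (r + 1) * k"
    unfolding M_def using real_nat_ceiling_ge[of "24 / \<epsilon>"] real_nat_ceiling_ge[of "24 * real r / \<epsilon>"]
    by (simp_all add: add.assoc add_increasing add_increasing2)
  obtain N where N: "\<And>n. n \<ge> N \<Longrightarrow> (\<Sum>j\<in>{M<..n}. 1 / real j) > 24 / \<epsilon>"
    using harmonic_tail_exceeds by blast
  show ?thesis
  proof (intro exI[of _ "N + M + 2"] allI impI)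
    fix E :: "'a \<Rightarrow> 'a \<Rightarrow> bool" and V
    assume "adjacency E \<and> finite V \<and> N + M + 2 \<le> card V \<and> \<not> contains_book E V r k \<and>
      qmax E V \<ge> 2 * (1 - 1 / real r) * real (card V) - 2 * real r / real (card V)"
    then have adj: "adjacency E" and V: "finite V" "N + M + 2 \<le> card V" "\<not> contains_book E V r k"
      and q: "qmax E V \<ge> 2 * a * real (card V) - 2 * real r / real (card V)" by (auto simp: a_def)
    interpret adjacency E by fact
    have low: "\<exists>w\<in>W. real (card (nbrs E W w)) \<le> (a - \<epsilon>) * real (card W)"
      if W: "finite W" "card W > M" "\<not> contains_book E W r k" "qmax E W > 2 * a * real (card W)" for W
    proof (rule ccontr)
      assume "\<not> ?thesis"
      then have "\<exists>c. (\<forall>v\<in>W. c v < r) \<and> (\<forall>u\<in>W. \<forall>v\<in>W. E u v \<longrightarrow> c u \<noteq> c v)"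
        using W M(3) by (intro dense_book_free_multipartite[OF W(1) r W(3)])
          (auto simp: a_def \<epsilon>_def not_le intro: less_imp_le)
      then obtain c where "\<And>v. v \<in> W \<Longrightarrow> c v < r" "\<And>u v. u \<in> W \<Longrightarrow> v \<in> W \<Longrightarrow> E u v \<Longrightarrow> c u \<noteq> c v"
        by blast
      moreover have "W \<noteq> {}" using W(2) by auto
      ultimately have "qmax E W \<le> 2 * a * real (card W)"
        unfolding a_def using r by (intro multipartite_qmax_le[OF W(1), where c = c]) auto
      then show False using W(4) by simp
    qed
    have deg: "real (card (nbrs E V u)) \<ge> (a - \<epsilon>) * real (card V)" if u: "u \<in> V" for u
    proof (rule ccontr)
      assume "\<not> ?thesis"
      then have u_low: "real (card (nbrs E V u)) \<le> (a - \<epsilon>) * real (card V)" by simp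
      define m where "m = real (card V)"
      have m: "m \<ge> real M + 2" using V(2) by (simp add: m_def)
      have mr: "m > 24 * real r / \<epsilon>" using m M(2) by simp
      then have "m * \<epsilon> > 24 * real r" using \<epsilon> by (simp add: pos_divide_less_eq)
      moreover have "m > 1" using m by simp
      ultimately have small: "2 * real r / m < \<epsilon> / 12" by (simp add: pos_divide_less_eq mult.commute)
      have "\<epsilon> * 1 \<le> \<epsilon> * m" using \<epsilon> \<open>m > 1\<close> by (intro mult_left_mono) auto
      have q': "(2 * a - \<epsilon>) * real (card V) \<le> qmax E V"
      proof -
        have "(2 * a - \<epsilon>) * m = 2 * a * m - \<epsilon> * m" by (simp add: algebra_simps)
        moreover have "2 * a * m - 2 * real r / m \<le> qmax E V" using q by (simp add: m_def)
        ultimately show ?thesis using small \<epsilon>(1) \<open>\<epsilon> * 1 \<le> \<epsilon> * m\<close> unfolding m_def[symmetric] by linarith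
      qed
      have "24 / \<epsilon> \<le> real (card V)" using m M(1) by (simp add: m_def)
      from qmax_density_increment[OF V(1) u \<epsilon> a q' u_low this]
      obtain w where w: "w \<in> V" and inc: "qmax E (V - {w}) \<ge> (qmax E V / m + \<epsilon> / (12 * m)) * (m - 1)"
        unfolding m_def by blast
      define W where "W = V - {w}"
      have W: "finite W" "card W = card V - 1" "\<not> contains_book E W r k"
        using V w contains_book_mono[of E W r k V] by (auto simp: W_def)
      have mW: "real (card W) = m - 1" using W(2) V(2) by (simp add: m_def)
      have "qmax E V / m \<ge> (2 * a * m - 2 * real r / m) / m"
        using q \<open>m > 1\<close> by (intro divide_right_mono) (auto simp: m_def)
      then have "qmax E V / m \<ge> 2 * a - (2 * real r / m) / m" using \<open>m > 1\<close> by (simp add: diff_divide_distrib)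
      moreover have "(2 * real r / m) / m < (\<epsilon> / 12) / m" using small \<open>m > 1\<close> by (intro divide_strict_right_mono) auto
      ultimately have "qmax E V / m + \<epsilon> / (12 * m) > 2 * a" by simp
      then have "(qmax E V / m + \<epsilon> / (12 * m)) * (m - 1) > 2 * a * (m - 1)"
        using \<open>m > 1\<close> by (intro mult_strict_right_mono) auto
      then have qW: "qmax E W > 2 * a * real (card W)" using inc by (simp add: W_def[symmetric] mW)
      have "qmax E W / real (card W) + \<epsilon> / 12 * (\<Sum>j\<in>{M<..card W}. 1 / real j) \<le> 2"
        by (rule qmax_excess_bound[OF \<epsilon> a M(1) low _ W(1) refl W(3) qW]) (use V(2) W(2) in auto)
      moreover have "\<epsilon> / 12 * (\<Sum>j\<in>{M<..card W}. 1 / real j) > \<epsilon> / 12 * (24 / \<epsilon>)"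
        using N[of "card W"] V(2) W(2) \<epsilon> by (intro mult_strict_left_mono) auto
      moreover have "qmax E W / real (card W) \<ge> 0"
      proof -
        have "card W > 0" using V(2) W(2) by simp
        then have "W \<noteq> {}" by auto
        then show ?thesis using qmax_nonneg[OF W(1)] by simp
      qed
      ultimately show False using \<epsilon> by simp
    qed
    show "\<exists>c. (\<forall>v\<in>V. c v < r) \<and> (\<forall>u\<in>V. \<forall>v\<in>V. E u v \<longrightarrow> c u \<noteq> c v)"
      by (rule dense_book_free_multipartite[OF V(1) r V(3)])
        (use deg V(2) M(3) in \<open>auto simp: a_def \<epsilon>_def\<close>)
  qed
qed

section \<open>Turan graphs\<close>

abbreviation turan_adj :: "nat \<Rightarrow> nat \<Rightarrow> nat \<Rightarrow> nat \<Rightarrow> bool" where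
  "turan_adj n r \<equiv> \<lambda>u v. (u, v) \<in> parcs (turan_graph n r)"

lemma turan_adj_iff: "turan_adj n r u v \<longleftrightarrow> u < n \<and> v < n \<and> u mod r \<noteq> v mod r"
  by (simp add: turan_graph_def complete_multipartite_def)

lemma pverts_turan [simp]: "pverts (turan_graph n r) = {..<n}"
  by (simp add: turan_graph_def complete_multipartite_def)

lemma pair_graph_turan: "pair_graph (turan_graph n r)"
proof -
  have "parcs (turan_graph n r) \<subseteq> {..<n} \<times> {..<n}" by (auto simp: turan_adj_iff)
  then have "finite (parcs (turan_graph n r))" by (rule finite_subset) simp
  then show ?thesis
    by unfold_locales (auto simp: turan_adj_iff symmetric_def sym_def)
qed

lemma adjacency_turan: "adjacency (turan_adj n r)"
  by (rule pair_graph_adjacency[OF pair_graph_turan])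

definition turan_part :: "nat \<Rightarrow> nat \<Rightarrow> nat \<Rightarrow> nat" where
  "turan_part n r i = card {v \<in> {..<n}. v mod r = i}"

lemma turan_part_cases: "i < r \<Longrightarrow> turan_part n r i = n div r \<or> turan_part n r i = n div r + 1"
  unfolding turan_part_def using turan_part_card[of i r n] by (auto split: if_splits)

lemma sum_turan_part: "r > 0 \<Longrightarrow> (\<Sum>i<r. turan_part n r i) = n"
  using adjacency.sum_part_sizes[OF adjacency_turan, of "{..<n}" "\<lambda>v. v mod r" r]
  by (simp add: turan_part_def)

text \<open>
  The class sizes deviate from \<open>n / r\<close> by at most \<open>1\<close>, so their squared deviations sum to at most \<open>r\<close>.
\<close>

lemma sum_turan_part_squares:
  assumes "r > 0"
  shows "(\<Sum>i<r. (real (turan_part n r i))\<^sup>2) \<le> (real n)\<^sup>2 / real r + real r"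
proof -
  define \<mu> where "\<mu> = real n / real r"
  have r\<mu>: "real r * \<mu> = real n" using assms by (simp add: \<mu>_def)
  have "real n = real (r * (n div r) + n mod r)" by simp
  then have n_eq: "real n = real r * real (n div r) + real (n mod r)" by (simp only: of_nat_add of_nat_mult)
  have "real (n mod r) \<le> real r" using assms by (simp add: less_imp_le)
  then have bounds: "real (n div r) \<le> \<mu>" "\<mu> \<le> real (n div r) + 1"
    using n_eq assms by (simp_all add: \<mu>_def field_simps)
  have "(\<Sum>i<r. (real (turan_part n r i) - \<mu>)\<^sup>2) \<le> (\<Sum>i<r. 1)"
  proof (rule sum_mono)
    fix i assume "i \<in> {..<r}"
    then have "\<bar>real (turan_part n r i) - \<mu>\<bar> \<le> 1" using turan_part_cases[of i r n] bounds by auto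
    then show "(real (turan_part n r i) - \<mu>)\<^sup>2 \<le> 1" by (simp add: abs_square_le_1)
  qed
  moreover have "(\<Sum>i<r. (real (turan_part n r i) - \<mu>)\<^sup>2)
      = (\<Sum>i<r. (real (turan_part n r i))\<^sup>2) - (real n)\<^sup>2 / real r"
  proof -
    have "(\<Sum>i<r. (real (turan_part n r i) - \<mu>)\<^sup>2)
        = (\<Sum>i<r. (real (turan_part n r i))\<^sup>2 + \<mu>\<^sup>2 - 2 * \<mu> * real (turan_part n r i))"
      by (intro sum.cong) (auto simp: power2_diff)
    also have "\<dots> = (\<Sum>i<r. (real (turan_part n r i))\<^sup>2) + real r * \<mu>\<^sup>2
        - 2 * \<mu> * (\<Sum>i<r. real (turan_part n r i))"
      unfolding sum_subtractf sum.distrib sum_distrib_left[symmetric] by simp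
    also have "(\<Sum>i<r. real (turan_part n r i)) = real n"
      using arg_cong[OF sum_turan_part[OF assms, of n], of real] by (simp only: of_nat_sum)
    also have "(\<Sum>i<r. (real (turan_part n r i))\<^sup>2) + real r * \<mu>\<^sup>2 - 2 * \<mu> * real n
        = (\<Sum>i<r. (real (turan_part n r i))\<^sup>2) - (real n)\<^sup>2 / real r"
      using assms by (simp add: \<mu>_def power2_eq_square)
    finally show ?thesis .
  qed
  moreover have "(\<Sum>i<r. 1 :: real) = real r" by simp
  ultimately show ?thesis by linarith
qed

lemma qmax_turan_ge:
  assumes "r > 0" "n > 0"
  shows "qmax (turan_adj n r) {..<n} \<ge> 2 * (1 - 1 / real r) * real n - 2 * real r / real n"
proof -
  interpret adjacency "turan_adj n r" by (rule adjacency_turan)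
  have deg: "real (card (nbrs (turan_adj n r) {..<n} u)) = real n - real (turan_part n r (u mod r))"
    if "u < n" for u
  proof -
    have "nbrs (turan_adj n r) {..<n} u = {..<n} - {v \<in> {..<n}. v mod r = u mod r}"
      using that by (auto simp: nbrs_def turan_adj_iff)
    moreover have "card {v \<in> {..<n}. v mod r = u mod r} \<le> n"
      using card_mono[of "{..<n}" "{v \<in> {..<n}. v mod r = u mod r}"] by auto
    moreover have "card ({..<n} - {v \<in> {..<n}. v mod r = u mod r})
        = n - card {v \<in> {..<n}. v mod r = u mod r}"
      by (subst card_Diff_subset) auto
    ultimately show ?thesis by (simp only: turan_part_def of_nat_diff)
  qed
  have "(\<Sum>u<n. real (turan_part n r (u mod r)))
      = (\<Sum>i<r. \<Sum>u\<in>{u \<in> {..<n}. u mod r = i}. real (turan_part n r (u mod r)))"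
    by (rule sum.group[where g = "\<lambda>u. u mod r", symmetric]) (use assms in auto)
  also have "\<dots> = (\<Sum>i<r. (real (turan_part n r i))\<^sup>2)"
  proof (intro sum.cong refl)
    fix i
    have "(\<Sum>u\<in>{u \<in> {..<n}. u mod r = i}. real (turan_part n r (u mod r)))
        = (\<Sum>u\<in>{u \<in> {..<n}. u mod r = i}. real (turan_part n r i))"
      by (intro sum.cong) auto
    then show "(\<Sum>u\<in>{u \<in> {..<n}. u mod r = i}. real (turan_part n r (u mod r)))
        = (real (turan_part n r i))\<^sup>2" by (simp add: turan_part_def power2_eq_square)
  qed
  finally have "(\<Sum>u<n. real (card (nbrs (turan_adj n r) {..<n} u)))
      = (real n)\<^sup>2 - (\<Sum>i<r. (real (turan_part n r i))\<^sup>2)"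
    using deg by (simp add: sum_subtractf power2_eq_square)
  then have "2 * ((real n)\<^sup>2 - (real n)\<^sup>2 / real r - real r) \<le> qmax (turan_adj n r) {..<n} * real n"
    using qmax_ge_average_degree[of "{..<n}"] sum_turan_part_squares[OF assms(1), of n] by simp
  then have "2 * ((real n)\<^sup>2 - (real n)\<^sup>2 / real r - real r) / real n \<le> qmax (turan_adj n r) {..<n}"
    using assms by (simp add: pos_divide_le_eq)
  moreover have "2 * ((real n)\<^sup>2 - (real n)\<^sup>2 / real r - real r) / real n
      = 2 * (1 - 1 / real r) * real n - 2 * real r / real n"
    using assms by (simp add: field_simps power2_eq_square)
  ultimately show ?thesis by simp
qed

lemma turan_shares:
  assumes "r > 0" "n > 0" and q: "qmax (turan_adj n r) {..<n} > real n"
  defines "p \<equiv> qmax (turan_adj n r) {..<n} - real n"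
  shows "(\<Sum>i<r. real (turan_part n r i) / (p + 2 * real (turan_part n r i))) = 1"
proof -
  interpret adjacency "turan_adj n r" by (rule adjacency_turan)
  have "\<forall>u\<in>{..<n}. \<forall>v\<in>{..<n}. u mod r \<noteq> v mod r \<longrightarrow> turan_adj n r u v" by (simp add: turan_adj_iff)
  moreover have "{..<n} \<noteq> {}" using assms(2) by auto
  ultimately show ?thesis
    using multipartite_shares(2)[of "{..<n}" "\<lambda>v. v mod r" r] assms(1) q
    by (simp add: turan_adj_iff turan_part_def p_def)
qed

context adjacency
begin

text \<open>
  The shares of \<open>G\<close> sum to at least \<open>1\<close>, those of the Turan graph to exactly \<open>1\<close>. At a common value of
  \<open>p\<close> the balanced sum is the larger one, and it decreases strictly in \<open>p\<close>; hence \<open>q(G)\<close> cannot be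
  larger. If the values of \<open>q\<close> agree, all these inequalities are equalities.
\<close>

lemma multipartite_qmax_le_turan:
  assumes fin: "finite V" and n: "card V = n" "n > 0" and r: "r > 0"
    and range: "\<And>v. v \<in> V \<Longrightarrow> c v < r"
    and proper: "\<And>u v. u \<in> V \<Longrightarrow> v \<in> V \<Longrightarrow> E u v \<Longrightarrow> c u \<noteq> c v"
    and qT: "qmax (turan_adj n r) {..<n} > real n"
  shows "qmax E V \<le> qmax (turan_adj n r) {..<n}"
    and "qmax E V = qmax (turan_adj n r) {..<n} \<Longrightarrow> u \<in> V \<Longrightarrow> v \<in> V \<Longrightarrow> c u \<noteq> c v \<Longrightarrow> E u v"
    and "qmax E V = qmax (turan_adj n r) {..<n} \<Longrightarrow> i < r \<Longrightarrow>
      card {v \<in> V. c v = i} = n div r \<or> card {v \<in> V. c v = i} = n div r + 1"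
proof -
  define Q where "Q = qmax (turan_adj n r) {..<n}"
  define size where "size = (\<lambda>i. card {v \<in> V. c v = i})"
  define share where "share = (\<lambda>p k. real k / (p + 2 * real k))"
  have ne: "V \<noteq> {}" using n by auto
  have sums: "(\<Sum>i<r. size i) = (\<Sum>i<r. turan_part n r i)"
    using sum_part_sizes[OF fin range] sum_turan_part[OF r] n by (simp add: size_def)
  have T: "(\<Sum>i<r. share (Q - real n) (turan_part n r i)) = 1"
    using turan_shares[OF r n(2) qT] by (simp add: share_def Q_def)
  have G: "1 \<le> (\<Sum>i<r. share (qmax E V - real n) (size i))"
    "(\<Sum>i<r. share (qmax E V - real n) (size i)) = 1 \<longleftrightarrow> (\<forall>u\<in>V. \<forall>v\<in>V. c u \<noteq> c v \<longrightarrow> E u v)"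
    if "qmax E V > real n"
    using multipartite_shares[OF fin ne range proper] that by (simp_all add: share_def size_def n)
  have bal: "(\<Sum>i<r. share p (size i)) \<le> (\<Sum>i<r. share p (turan_part n r i))"
    "(\<Sum>i<r. share p (size i)) = (\<Sum>i<r. share p (turan_part n r i)) \<Longrightarrow> i < r \<Longrightarrow>
      size i = n div r \<or> size i = n div r + 1" if "p > 0" for p i
    using sum_share_balanced[OF that sums, where s = "n div r"] turan_part_cases[where r = r and n = n]
    by (simp_all add: share_def)
  show le: "qmax E V \<le> qmax (turan_adj n r) {..<n}"
  proof (rule ccontr)
    assume "\<not> ?thesis"
    then have gt: "qmax E V > Q" by (simp add: Q_def)
    have Qn: "Q > real n" using qT by (simp add: Q_def)
    have anti: "share (qmax E V - real n) k \<le> share (Q - real n) k" for k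
      unfolding share_def using gt Qn by (intro divide_left_mono mult_pos_pos) auto
    have "\<exists>i<r. turan_part n r i > 0"
    proof (rule ccontr)
      assume "\<not> ?thesis"
      then have "(\<Sum>i<r. turan_part n r i) = 0" by simp
      then show False using sum_turan_part[OF r] n by simp
    qed
    then obtain j where j: "j < r" "turan_part n r j > 0" by blast
    have "share (qmax E V - real n) (turan_part n r j) < share (Q - real n) (turan_part n r j)"
      unfolding share_def using gt Qn j(2) by (intro divide_strict_left_mono mult_pos_pos) auto
    then have "(\<Sum>i<r. share (qmax E V - real n) (turan_part n r i)) < 1"
      unfolding T[symmetric] using j(1) anti by (intro sum_strict_mono_ex1) auto
    then show False using G(1) bal(1)[of "qmax E V - real n"] gt Qn by simp
  qed
  assume eq: "qmax E V = qmax (turan_adj n r) {..<n}"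
  then have q: "qmax E V = Q" "Q > real n" using qT by (auto simp: Q_def)
  have one: "(\<Sum>i<r. share (Q - real n) (size i)) = 1"
    using G(1) bal(1)[of "Q - real n"] T q by simp
  show "u \<in> V \<Longrightarrow> v \<in> V \<Longrightarrow> c u \<noteq> c v \<Longrightarrow> E u v" using G(2) one q by simp
  show "i < r \<Longrightarrow> card {v \<in> V. c v = i} = n div r \<or> card {v \<in> V. c v = i} = n div r + 1"
    using bal(2)[of "Q - real n" i] one T q by (simp add: size_def)
qed

end

text \<open>
  Exactly \<open>n mod r\<close> classes have the larger size \<open>n div r + 1\<close>, as for the residue classes modulo \<open>r\<close>.
  So a permutation \<open>\<pi>\<close> of the class indices matches the sizes, and the classes can be mapped one by one.
\<close>

lemma balanced_multipartite_bij_turan: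
  fixes c :: "'a \<Rightarrow> nat"
  assumes fin: "finite V" and n: "card V = n" and r: "r > 0"
    and range: "\<And>v. v \<in> V \<Longrightarrow> c v < r"
    and size: "\<And>i. i < r \<Longrightarrow> card {v \<in> V. c v = i} = n div r \<or> card {v \<in> V. c v = i} = n div r + 1"
  obtains f where "bij_betw f V {..<n}"
    "\<And>u v. u \<in> V \<Longrightarrow> v \<in> V \<Longrightarrow> c u = c v \<longleftrightarrow> f u mod r = f v mod r"
proof -
  define P where "P = (\<lambda>i. {v \<in> V. c v = i})"
  define T where "T = (\<lambda>i. {v \<in> {..<n}. v mod r = i})"
  define A where "A = {i \<in> {..<r}. card (P i) = n div r + 1}"
  have A: "A \<subseteq> {..<r}" "finite A" by (auto simp: A_def)
  have sizeP: "card (P i) = n div r + (if i \<in> A then 1 else 0)" if "i < r" for i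
    using size[OF that] that by (auto simp: P_def A_def)
  have sizeT: "card (T i) = n div r + (if i \<in> {..<n mod r} then 1 else 0)" if "i < r" for i
    using turan_part_card[OF that, of n] by (simp add: T_def)
  have "(\<Sum>i<r. card (P i)) = card V"
    using sum.group[of V "{..<r}" c "\<lambda>_. 1 :: nat"] fin range by (auto simp: P_def image_subset_iff)
  moreover have "(\<Sum>i<r. card (P i)) = (\<Sum>i<r. n div r + (if i \<in> A then 1 else 0))"
    by (intro sum.cong) (use sizeP in auto)
  moreover have "\<dots> = r * (n div r) + card A"
    using A by (simp add: sum.distrib sum.If_cases Int_absorb1)
  ultimately have "r * (n div r) + card A = r * (n div r) + n mod r" using n by simp
  then have "card A = n mod r" by (rule add_left_imp_eq)
  then have "card A = card {..<n mod r}" by simp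
  then have "\<exists>\<alpha>. bij_betw \<alpha> A {..<n mod r}" by (intro finite_same_card_bij A(2) finite_lessThan)
  then obtain \<alpha> where \<alpha>: "bij_betw \<alpha> A {..<n mod r}" ..
  have sub: "{..<n mod r} \<subseteq> {..<r}" using mod_less_divisor[OF r, of n] by auto
  have "card ({..<r} - A) = card ({..<r} - {..<n mod r})"
    using A sub \<open>card A = card {..<n mod r}\<close> by (simp add: card_Diff_subset)
  then have "\<exists>\<beta>. bij_betw \<beta> ({..<r} - A) ({..<r} - {..<n mod r})"
    by (intro finite_same_card_bij finite_Diff finite_lessThan)
  then obtain \<beta> where \<beta>: "bij_betw \<beta> ({..<r} - A) ({..<r} - {..<n mod r})" ..
  define \<pi> where "\<pi> = (\<lambda>i. if i \<in> A then \<alpha> i else \<beta> i)"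
  have \<pi>A: "bij_betw \<pi> A {..<n mod r}" using \<alpha> by (subst bij_betw_cong[of _ _ \<alpha>]) (auto simp: \<pi>_def)
  have \<pi>B: "bij_betw \<pi> ({..<r} - A) ({..<r} - {..<n mod r})"
    using \<beta> by (subst bij_betw_cong[of _ _ \<beta>]) (auto simp: \<pi>_def)
  have "bij_betw \<pi> (A \<union> ({..<r} - A)) ({..<n mod r} \<union> ({..<r} - {..<n mod r}))"
    by (rule bij_betw_combine[OF \<pi>A \<pi>B]) auto
  moreover have "A \<union> ({..<r} - A) = {..<r}" "{..<n mod r} \<union> ({..<r} - {..<n mod r}) = {..<r}"
    using A(1) sub by auto
  ultimately have \<pi>: "bij_betw \<pi> {..<r} {..<r}" by (simp only:)
  have \<pi>r: "\<pi> i < r" if "i < r" for i using \<pi> that by (auto simp: bij_betw_def)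
  have \<pi>_inj: "\<pi> i = \<pi> j \<longleftrightarrow> i = j" if "i < r" "j < r" for i j
    using \<pi> that by (auto simp: bij_betw_def dest: inj_onD)
  have in_A: "\<pi> i \<in> {..<n mod r} \<longleftrightarrow> i \<in> A" if "i < r" for i
    using \<pi>A \<pi>B that unfolding bij_betw_def by blast
  have "\<exists>h. bij_betw h (P i) (T (\<pi> i))" if i: "i < r" for i
  proof (rule finite_same_card_bij)
    show "card (P i) = card (T (\<pi> i))"
      unfolding sizeP[OF i] sizeT[OF \<pi>r[OF i]] in_A[OF i] ..
  qed (use fin in \<open>auto simp: P_def T_def\<close>)
  then obtain h where h: "\<And>i. i < r \<Longrightarrow> bij_betw (h i) (P i) (T (\<pi> i))" by metis
  define f where "f = (\<lambda>v. h (c v) v)"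
  have fT: "f v \<in> T (\<pi> (c v))" if "v \<in> V" for v
    using h[OF range[OF that]] that by (auto simp: f_def bij_betw_def P_def)
  have residue: "f v mod r = \<pi> (c v)" "f v < n" if "v \<in> V" for v
    using fT[OF that] by (auto simp: T_def)
  have inj: "inj_on f V"
  proof (rule inj_onI)
    fix u v assume uv: "u \<in> V" "v \<in> V" "f u = f v"
    then have "c u = c v" using residue(1) range \<pi>_inj by metis
    then show "u = v" using uv h[OF range[OF uv(1)]] by (auto simp: bij_betw_def f_def P_def dest: inj_onD)
  qed
  moreover have "f ` V = {..<n}"
    by (rule card_subset_eq) (use residue(2) inj n in \<open>auto simp: card_image\<close>)
  ultimately have "bij_betw f V {..<n}" by (simp add: bij_betw_def)
  moreover have "c u = c v \<longleftrightarrow> f u mod r = f v mod r" if "u \<in> V" "v \<in> V" for u v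
    using residue(1) that range \<pi>_inj by simp
  ultimately show ?thesis by (rule that)
qed

section \<open>Isomorphisms and embeddings\<close>

lemma digraph_iso_with_projI:
  assumes "pair_wf_digraph G" "pair_wf_digraph H" and f: "bij_betw f (pverts G) (pverts H)"
    and arcs: "\<And>u v. u \<in> pverts G \<Longrightarrow> v \<in> pverts G \<Longrightarrow> (u, v) \<in> parcs G \<longleftrightarrow> (f u, f v) \<in> parcs H"
  shows "digraph_iso (with_proj G) (with_proj H)"
proof -
  interpret G: pair_wf_digraph G by fact
  interpret H: pair_wf_digraph H by fact
  define hom where "hom = \<lparr> iso_verts = f, iso_arcs = map_prod f f,
    iso_head = (snd :: 'b \<times> 'b \<Rightarrow> 'b), iso_tail = fst \<rparr>"
  have inj: "inj_on f (pverts G)" "f ` pverts G = pverts H" using f by (auto simp: bij_betw_def)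
  have "inj_on (map_prod f f) (parcs G)"
  proof (rule inj_onI)
    fix d e assume "d \<in> parcs G" "e \<in> parcs G" "map_prod f f d = map_prod f f e"
    then show "d = e"
      using inj_onD[OF inj(1), of "fst d" "fst e"] inj_onD[OF inj(1), of "snd d" "snd e"]
        G.arc_fst_in_verts G.arc_snd_in_verts by (simp add: prod_eq_iff)
  qed
  then have "pre_digraph.digraph_isomorphism (with_proj G) hom"
    using inj(1) G.wf_digraph_axioms by (simp add: pre_digraph.digraph_isomorphism_def hom_def)
  moreover have "map_prod f f ` parcs G = parcs H"
  proof (intro equalityI subsetI)
    fix e assume e: "e \<in> parcs H"
    then have "fst e \<in> f ` pverts G" "snd e \<in> f ` pverts G"
      using inj(2) H.arc_fst_in_verts H.arc_snd_in_verts by auto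
    then obtain u v where "u \<in> pverts G" "v \<in> pverts G" "e = (f u, f v)" by (metis imageE prod.collapse)
    then show "e \<in> map_prod f f ` parcs G" using arcs e by (auto intro!: image_eqI[of _ _ "(u, v)"])
  qed (use arcs in \<open>auto dest: G.in_arcsD1 G.in_arcsD2\<close>)
  then have "with_proj H = app_iso hom (with_proj G)"
    using inj(2) by (simp add: app_iso_def hom_def with_proj_def)
  ultimately show ?thesis unfolding digraph_iso_def by blast
qed

lemma digraph_iso_with_projD:
  assumes "digraph_iso (with_proj G) (with_proj H)"
  obtains f where "bij_betw f (pverts G) (pverts H)"
    "\<And>u v. u \<in> pverts G \<Longrightarrow> v \<in> pverts G \<Longrightarrow> (u, v) \<in> parcs G \<longleftrightarrow> (f u, f v) \<in> parcs H"
proof -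
  obtain hom where hom: "pre_digraph.digraph_isomorphism (with_proj G) hom"
    and H: "with_proj H = app_iso hom (with_proj G)"
    using assms unfolding digraph_iso_def by blast
  define f where "f = iso_verts hom"
  have inj: "inj_on f (pverts G)" using hom by (simp add: pre_digraph.digraph_isomorphism_def f_def)
  have verts: "pverts H = f ` pverts G" and arcs: "parcs H = iso_arcs hom ` parcs G"
    and ends: "iso_tail hom = fst" "iso_head hom = snd"
    using H by (simp_all add: app_iso_def with_proj_def f_def)
  have wf: "pair_wf_digraph G" using hom by (simp add: pre_digraph.digraph_isomorphism_def wf_digraph_wp_iff)
  have arc: "iso_arcs hom e = (f (fst e), f (snd e))" if "e \<in> parcs G" for e
    using hom that ends by (simp add: pre_digraph.digraph_isomorphism_def f_def prod_eq_iff)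
  show ?thesis
  proof (rule that[of f])
    show "bij_betw f (pverts G) (pverts H)" using inj verts by (simp add: bij_betw_def)
    fix u v assume uv: "u \<in> pverts G" "v \<in> pverts G"
    show "(u, v) \<in> parcs G \<longleftrightarrow> (f u, f v) \<in> parcs H"
    proof
      assume "(u, v) \<in> parcs G"
      then show "(f u, f v) \<in> parcs H" unfolding arcs using arc[of "(u, v)"] by force
    next
      assume "(f u, f v) \<in> parcs H"
      then obtain e where e: "e \<in> parcs G" "(f u, f v) = iso_arcs hom e" unfolding arcs by auto
      then have "f u = f (fst e)" "f v = f (snd e)" using arc by auto
      moreover have "fst e \<in> pverts G" "snd e \<in> pverts G"
        using pair_wf_digraph.arc_fst_in_verts[OF wf e(1)] pair_wf_digraph.arc_snd_in_verts[OF wf e(1)]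
        by auto
      ultimately have "u = fst e" "v = snd e" using inj uv by (auto dest: inj_onD)
      then show "(u, v) \<in> parcs G" using e(1) by simp
    qed
  qed
qed

lemma qmax_le_if_bij:
  assumes E: "adjacency E" and F: "adjacency F" and fin: "finite V" "V \<noteq> {}"
    and f: "bij_betw f V W" and arcs: "\<And>u v. u \<in> V \<Longrightarrow> v \<in> V \<Longrightarrow> E u v \<longleftrightarrow> F (f u) (f v)"
  shows "qmax E V \<le> qmax F W"
proof -
  interpret E: adjacency E by fact
  interpret F: adjacency F by fact
  obtain x where x: "\<And>v. x v \<ge> 0" "(\<Sum>v\<in>V. (x v)\<^sup>2) = 1"
    "\<And>u. u \<in> V \<Longrightarrow> qapply E V x u = qmax E V * x u" "qform E V x = qmax E V"
    by (rule E.qmax_eigenvector[OF fin]) (rule that)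
  define y where "y = (\<lambda>w. x (inv_into V f w))"
  have inj: "inj_on f V" "W = f ` V" using f by (auto simp: bij_betw_def)
  have y: "y (f v) = x v" if "v \<in> V" for v using that inj(1) by (simp add: y_def)
  have sums: "(\<Sum>w\<in>W. (y w)\<^sup>2) = 1"
    using sum.reindex_bij_betw[OF f, of "\<lambda>w. (y w)\<^sup>2"] x(2) y by simp
  have apply_eq: "qapply F W y (f u) = qapply E V x u" if u: "u \<in> V" for u
  proof -
    have "nbrs F W (f u) = f ` nbrs E V u" using arcs[OF u] by (auto simp: nbrs_def inj(2))
    moreover have "inj_on f (nbrs E V u)" using inj(1) by (rule inj_on_subset) (auto simp: nbrs_def)
    ultimately have "qapply F W y (f u) = (\<Sum>v\<in>nbrs E V u. y (f u) + y (f v))"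
      by (simp only: qapply_def sum.reindex o_def)
    also have "\<dots> = qapply E V x u"
      unfolding qapply_def by (intro sum.cong) (use y u in \<open>auto simp: nbrs_def\<close>)
    finally show ?thesis .
  qed
  have "qform F W y = (\<Sum>u\<in>V. y (f u) * qapply F W y (f u))"
    unfolding qform_def using sum.reindex_bij_betw[OF f, of "\<lambda>w. y w * qapply F W y w"] by simp
  also have "\<dots> = qmax E V" using y apply_eq x(4) by (simp add: qform_def)
  finally show ?thesis
    using F.qform_le_qmax[of W y] sums fin inj(2) by simp
qed

lemma qmax_eq_if_bij:
  assumes E: "adjacency E" and F: "adjacency F" and fin: "finite V" "V \<noteq> {}"
    and f: "bij_betw f V W" and arcs: "\<And>u v. u \<in> V \<Longrightarrow> v \<in> V \<Longrightarrow> E u v \<longleftrightarrow> F (f u) (f v)"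
  shows "qmax E V = qmax F W"
proof (rule antisym)
  show "qmax E V \<le> qmax F W" by (rule qmax_le_if_bij[OF assms])
  have W: "W = f ` V" "inj_on f V" using f by (auto simp: bij_betw_def)
  show "qmax F W \<le> qmax E V"
  proof (rule qmax_le_if_bij[OF F E _ _ bij_betw_inv_into[OF f]])
    fix u v assume "u \<in> W" "v \<in> W"
    then obtain u' v' where "u' \<in> V" "v' \<in> V" "u = f u'" "v = f v'" using W by auto
    then show "F u v \<longleftrightarrow> E (inv_into V f u) (inv_into V f v)" using W(2) arcs by simp
  qed (use fin W in auto)
qed

text \<open>
  The clique and its common neighbours are disjoint, since no vertex is adjacent to itself, so together
  they carry a copy of the book; additional edges between the common neighbours are allowed.
\<close>

lemma book_free_if_subgraph_free:
  assumes "pair_graph G" and free: "subgraph_free (generalized_book r k) G"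
  shows "\<not> contains_book (\<lambda>u v. (u, v) \<in> parcs G) (pverts G) r k"
proof
  interpret pair_graph G by fact
  interpret adjacency "\<lambda>u v. (u, v) \<in> parcs G" by (rule pair_graph_adjacency) fact
  assume "contains_book (\<lambda>u v. (u, v) \<in> parcs G) (pverts G) r k"
  then obtain K C where K: "K \<subseteq> pverts G" "card K = r" "clique (\<lambda>u v. (u, v) \<in> parcs G) K"
    and C: "C \<subseteq> pverts G" "card C = k" "\<forall>u\<in>K. \<forall>v\<in>C. (u, v) \<in> parcs G"
    unfolding contains_book_def by auto
  have fin: "finite K" "finite C" using K C pair_finite_verts finite_subset by blast+
  obtain f where f: "bij_betw f {..<r} K"
    using ex_bij_betw_nat_finite[OF fin(1)] K(2) by (auto simp: atLeast0LessThan)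
  obtain g where g: "bij_betw g {..<k} C"
    using ex_bij_betw_nat_finite[OF fin(2)] C(2) by (auto simp: atLeast0LessThan)
  define h where "h = case_sum f g"
  define B where "B = generalized_book r k"
  have Bv: "pverts B = Inl ` {..<r} \<union> Inr ` {..<k}"
    by (auto simp: B_def generalized_book_def graph_join_def complete_graph_def edgeless_graph_def)
  have Ba: "parcs B = {(Inl i, Inl j) |i j. i < r \<and> j < r \<and> i \<noteq> j} \<union> {(Inl i, Inr j) |i j. i < r \<and> j < k}
      \<union> {(Inr j, Inl i) |i j. i < r \<and> j < k}"
    by (force simp: B_def generalized_book_def graph_join_def complete_graph_def edgeless_graph_def)
  have fK: "f i \<in> K" "f i = f j \<longleftrightarrow> i = j" if "i < r" "j < r" for i j
    using f that by (auto simp: bij_betw_def dest: inj_onD)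
  have gC: "g i \<in> C" "g i = g j \<longleftrightarrow> i = j" if "i < k" "j < k" for i j
    using g that by (auto simp: bij_betw_def dest: inj_onD)
  have disj: "u \<noteq> v" if "u \<in> K" "v \<in> C" for u v using C(3) that irrefl by auto
  have fg: "f i \<noteq> g j" if "i < r" "j < k" for i j
    using disj fK(1)[of i i] gC(1)[of j j] that by simp
  have inj: "inj_on h (pverts B)"
    using fK(2) gC(2) fg fg[symmetric] unfolding inj_on_def Bv h_def by auto
  have hV: "h ` pverts B \<subseteq> pverts G" using fK(1) gC(1) K(1) C(1) by (auto simp: Bv h_def)
  have arcs: "map_prod h h ` parcs B \<subseteq> parcs G"
    using fK gC K(3) C(3) sym by (auto simp: Ba h_def clique_def)
  have wfB: "pair_wf_digraph B" by unfold_locales (auto simp: Ba Bv)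
  define H where "H = \<lparr> pverts = h ` pverts B, parcs = map_prod h h ` parcs B \<rparr>"
  have wfH: "pair_wf_digraph H"
  proof
    fix e assume "e \<in> parcs H"
    then obtain u v where "(u, v) \<in> parcs B" "e = (h u, h v)" by (auto simp: H_def)
    then show "fst e \<in> pverts H" "snd e \<in> pverts H"
      using pair_wf_digraph.in_arcsD1[OF wfB] pair_wf_digraph.in_arcsD2[OF wfB] by (auto simp: H_def)
  qed
  have "subgraph (with_proj H) (with_proj G)"
    unfolding subgraph_def using hV arcs wfH wf_digraph_axioms
    by (simp add: H_def wf_digraph_wp_iff compatible_def)
  moreover have "digraph_iso (with_proj H) (with_proj B)"
  proof (rule digraph_iso_with_projI[OF wfH wfB])
    show "bij_betw (inv_into (pverts B) h) (pverts H) (pverts B)"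
      using inj by (intro bij_betw_inv_into) (simp add: bij_betw_def H_def)
    fix u v assume "u \<in> pverts H" "v \<in> pverts H"
    then obtain a b where ab: "a \<in> pverts B" "b \<in> pverts B" "u = h a" "v = h b" by (auto simp: H_def)
    have "(h a, h b) \<in> map_prod h h ` parcs B \<longleftrightarrow> (a, b) \<in> parcs B"
    proof
      assume "(h a, h b) \<in> map_prod h h ` parcs B"
      then obtain c d where cd: "(c, d) \<in> parcs B" "h a = h c" "h b = h d" by auto
      then have "c \<in> pverts B" "d \<in> pverts B"
        using pair_wf_digraph.in_arcsD1[OF wfB] pair_wf_digraph.in_arcsD2[OF wfB] by auto
      then have "a = c" "b = d" using cd ab inj by (auto dest: inj_onD)
      then show "(a, b) \<in> parcs B" using cd by simp
    qed (auto intro: image_eqI[of _ _ "(a, b)"])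
    then show "(u, v) \<in> parcs H \<longleftrightarrow> (inv_into (pverts B) h u, inv_into (pverts B) h v) \<in> parcs B"
      using ab inj by (simp add: H_def)
  qed
  ultimately show False using free unfolding subgraph_free_def B_def by blast
qed

section \<open>The extremal theorem\<close>

theorem corollary2p3:
  fixes r k :: nat
  assumes "r \<ge> 3" and "k \<ge> 1"
  shows "\<exists>N. \<forall>n\<ge>N. \<forall>G :: 'a pair_pre_digraph.
    pair_graph G \<and> card (pverts G) = n \<and> subgraph_free (generalized_book r k) G \<longrightarrow>
      signless_spectral_radius G \<le> signless_spectral_radius (turan_graph n r) \<and>
      (signless_spectral_radius G = signless_spectral_radius (turan_graph n r) \<longleftrightarrow>
        digraph_iso (with_proj G) (with_proj (turan_graph n r)))"
proof -
  obtain N where N: "\<forall>(E :: 'a \<Rightarrow> 'a \<Rightarrow> bool) V. adjacency E \<and> finite V \<and> card V \<ge> N \<and>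
    \<not> contains_book E V r k \<and>
    qmax E V \<ge> 2 * (1 - 1 / real r) * real (card V) - 2 * real r / real (card V) \<longrightarrow>
    (\<exists>c. (\<forall>v\<in>V. c v < r) \<and> (\<forall>u\<in>V. \<forall>v\<in>V. E u v \<longrightarrow> c u \<noteq> c v))"
    using near_extremal_multipartite[OF assms(1), of k] ..
  show ?thesis
  proof (intro exI[of _ "N + 6 * r"] allI impI)
    fix n and G :: "'a pair_pre_digraph"
    assume n: "n \<ge> N + 6 * r"
      and "pair_graph G \<and> card (pverts G) = n \<and> subgraph_free (generalized_book r k) G"
    then have G: "pair_graph G" and card: "card (pverts G) = n"
      and free: "subgraph_free (generalized_book r k) G" by auto
    interpret pair_graph G by fact
    define V where "V = pverts G"
    define E where "E = (\<lambda>u v. (u, v) \<in> parcs G)"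
    define Q where "Q = qmax (turan_adj n r) {..<n}"
    interpret adjacency E unfolding E_def by (rule pair_graph_adjacency) fact
    have r: "r > 0" and n0: "n > 0" using assms n by auto
    have V: "finite V" "card V = n" "V \<noteq> {}"
      using pair_finite_verts card n0 by (auto simp: V_def)
    have qG: "signless_spectral_radius G = qmax E V"
      using signless_spectral_radius_eq_qmax[OF G] V by (simp add: V_def E_def)
    have qT: "signless_spectral_radius (turan_graph n r) = Q"
      using signless_spectral_radius_eq_qmax[OF pair_graph_turan, of n r] n0 by (simp add: Q_def lessThan_empty_iff)
    have Q_ge: "Q \<ge> 2 * (1 - 1 / real r) * real n - 2 * real r / real n"
      unfolding Q_def by (rule qmax_turan_ge[OF r n0])
    have "Q > real n"
    proof -
      have "1 / real r \<le> 1 / 3" using assms(1) by (simp add: field_simps)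
      then have "(4 / 3) * real n \<le> 2 * (1 - 1 / real r) * real n" by (intro mult_right_mono) auto
      moreover have "2 * real r / real n \<le> 1 / 3" using n n0 by (simp add: field_simps)
      moreover have "real n \<ge> 2" using n assms(1) by simp
      ultimately show ?thesis using Q_ge by linarith
    qed
    have book: "\<not> contains_book E V r k"
      unfolding E_def V_def by (rule book_free_if_subgraph_free[OF G free])
    have main: "qmax E V \<le> Q \<and> (qmax E V = Q \<longrightarrow> digraph_iso (with_proj G) (with_proj (turan_graph n r)))"
    proof (cases "qmax E V \<ge> Q")
      case True
      have "\<exists>c. (\<forall>v\<in>V. c v < r) \<and> (\<forall>u\<in>V. \<forall>v\<in>V. E u v \<longrightarrow> c u \<noteq> c v)"
        by (rule N[rule_format]) (use adjacency_axioms V(1,2) book True Q_ge n in auto)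
      then obtain c where c: "\<And>v. v \<in> V \<Longrightarrow> c v < r"
        "\<And>u v. u \<in> V \<Longrightarrow> v \<in> V \<Longrightarrow> E u v \<Longrightarrow> c u \<noteq> c v" by blast
      note qTn = \<open>Q > real n\<close>[unfolded Q_def]
      have le: "qmax E V \<le> Q"
        unfolding Q_def
        by (rule multipartite_qmax_le_turan(1)[where c = c, OF V(1,2) n0 r _ _ qTn]) (rule c; assumption)+
      have "digraph_iso (with_proj G) (with_proj (turan_graph n r))" if eq: "qmax E V = Q"
      proof -
        have complete: "E u v" if "u \<in> V" "v \<in> V" "c u \<noteq> c v" for u v
          by (rule multipartite_qmax_le_turan(2)[where c = c, OF V(1,2) n0 r _ _ qTn eq[unfolded Q_def] that])
            (rule c; assumption)+
        have size: "card {v \<in> V. c v = i} = n div r \<or> card {v \<in> V. c v = i} = n div r + 1" if "i < r" for i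
          by (rule multipartite_qmax_le_turan(3)[where c = c, OF V(1,2) n0 r _ _ qTn eq[unfolded Q_def] that])
            (rule c; assumption)+
        obtain f where f: "bij_betw f V {..<n}"
          "\<And>u v. u \<in> V \<Longrightarrow> v \<in> V \<Longrightarrow> c u = c v \<longleftrightarrow> f u mod r = f v mod r"
          by (rule balanced_multipartite_bij_turan[where c = c, OF V(1,2) r])
            (rule c(1), assumption, rule size, assumption, rule that)
        have "E u v \<longleftrightarrow> turan_adj n r (f u) (f v)" if "u \<in> V" "v \<in> V" for u v
        proof -
          have "f u < n" "f v < n" using f(1) that by (auto simp: bij_betw_def)
          moreover have "E u v \<longleftrightarrow> c u \<noteq> c v" using complete[OF that] c(2)[OF that] by blast
          ultimately show ?thesis using f(2)[OF that] by (simp add: turan_adj_iff)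
        qed
        then show ?thesis
          using f(1) pair_wf_digraph pair_graph_turan[THEN pair_graph.axioms(1), THEN pair_digraph.pair_wf_digraph]
          by (intro digraph_iso_with_projI[of _ _ f]) (auto simp: V_def E_def)
      qed
      then show ?thesis using le by simp
    qed simp
    moreover have "qmax E V = Q" if iso: "digraph_iso (with_proj G) (with_proj (turan_graph n r))"
    proof -
      obtain f where f: "bij_betw f (pverts G) (pverts (turan_graph n r))"
        "\<And>u v. u \<in> pverts G \<Longrightarrow> v \<in> pverts G \<Longrightarrow> (u, v) \<in> parcs G \<longleftrightarrow> turan_adj n r (f u) (f v)"
        by (rule digraph_iso_with_projD[OF iso]) (rule that)
      show ?thesis unfolding Q_def
        by (rule qmax_eq_if_bij[OF adjacency_axioms adjacency_turan V(1,3)])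
          (use f in \<open>auto simp: V_def E_def\<close>)
    qed
    ultimately show "signless_spectral_radius G \<le> signless_spectral_radius (turan_graph n r) \<and>
      (signless_spectral_radius G = signless_spectral_radius (turan_graph n r) \<longleftrightarrow>
        digraph_iso (with_proj G) (with_proj (turan_graph n r)))"
      unfolding qG qT by blast
  qed
qed

end
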